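(* Let $\mathbb{F}$ be an algebraically closed field. Every $(n,m,k,\epsilon)$ linear seeded rank extractor for subspaces is also an $(n,m,k,\epsilon)$ linear seeded rank extractor for varieties.
   Context: Let $n\geq m$. A tuple $(\varphi_i)_{i\in[\ell]}$ of polynomial maps $\mathbb{F}^n\to\mathbb{F}^m$ is an $(n,m,k,\epsilon)$ seeded rank extractor for varieties (resp. subspaces) if for every affine variety (Zariski-closed subset) (resp. linear subspace) $V\subseteq\mathbb{F}^n$ of dimension at least $k$, all but at most an $\epsilon$-fraction of the indices $i$ satisfy $\dim\overline{\varphi_i(V)}=m$, where $\overline{\cdot}$ denotes Zariski closure. It is linear if each $\varphi_i$ is defined by linear polynomials. *)

theory Defs
  imports
    "HOL-Analysis.Analysis"
    "HOL-Computational_Algebra.Polynomial"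
    "HOL-Library.Poly_Mapping"
begin

text \<open>
  Polynomials in the variables \<open>X\<^sub>j\<close>, \<open>j :: 'n\<close>: finitely supported maps from exponent
  vectors to coefficients.
\<close>

type_synonym ('n, 'a) mvpoly = "('n \<Rightarrow>\<^sub>0 nat) \<Rightarrow>\<^sub>0 'a"

definition mvpoly_eval :: "('n::finite, 'a::comm_ring_1) mvpoly \<Rightarrow> 'a ^ 'n \<Rightarrow> 'a" where
  "mvpoly_eval p x =
     (\<Sum>e\<in>Poly_Mapping.keys p. Poly_Mapping.lookup p e * (\<Prod>j\<in>UNIV. (x $ j) ^ Poly_Mapping.lookup e j))"

definition linear_mvpoly :: "('n::finite, 'a::comm_ring_1) mvpoly \<Rightarrow> bool" where
  \<comment> \<open>total degree at most 1; a constant term is allowed\<close>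
  "linear_mvpoly p \<longleftrightarrow> (\<forall>e\<in>Poly_Mapping.keys p. (\<Sum>j\<in>UNIV. Poly_Mapping.lookup e j) \<le> 1)"

definition polynomial_map :: "('a::comm_ring_1 ^ 'n \<Rightarrow> 'a ^ 'm) \<Rightarrow> bool" where
  "polynomial_map f \<longleftrightarrow>
     (\<exists>P :: 'm \<Rightarrow> ('n, 'a) mvpoly. \<forall>x j. f x $ j = mvpoly_eval (P j) x)"

definition linear_polynomial_map :: "('a::comm_ring_1 ^ 'n \<Rightarrow> 'a ^ 'm) \<Rightarrow> bool" where
  "linear_polynomial_map f \<longleftrightarrow>
     (\<exists>P :: 'm \<Rightarrow> ('n, 'a) mvpoly.
        (\<forall>j. linear_mvpoly (P j)) \<and> (\<forall>x j. f x $ j = mvpoly_eval (P j) x))"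

definition zariski_closed :: "('a::field ^ 'n) set \<Rightarrow> bool" where
  "zariski_closed V \<longleftrightarrow>
     (\<exists>S :: ('n, 'a) mvpoly set. V = {x. \<forall>p\<in>S. mvpoly_eval p x = 0})"

definition zariski_closure :: "('a::field ^ 'n) set \<Rightarrow> ('a ^ 'n) set" where
  "zariski_closure A = \<Inter>{V. zariski_closed V \<and> A \<subseteq> V}"

definition zariski_irreducible :: "('a::field ^ 'n) set \<Rightarrow> bool" where
  "zariski_irreducible V \<longleftrightarrow>
     zariski_closed V \<and> V \<noteq> {} \<and>
     (\<forall>A B. zariski_closed A \<and> zariski_closed B \<and> V = A \<union> B \<longrightarrow> V = A \<or> V = B)"

text \<open>
  Dimension of a Zariski-closed set: the supremum of the lengths \<open>d\<close> of chains
  \<open>C\<^sub>0 \<subset> \<dots> \<subset> C\<^sub>d\<close> of irreducible closed subsets. It is taken in \<open>ereal\<close>, so that the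
  empty set has dimension \<open>-\<infinity>\<close>.
\<close>

definition zariski_dim :: "('a::field ^ 'n) set \<Rightarrow> ereal" where
  "zariski_dim V =
     Sup {ereal (real d) | d. \<exists>C :: nat \<Rightarrow> ('a ^ 'n) set.
            (\<forall>i\<le>d. zariski_irreducible (C i) \<and> C i \<subseteq> V) \<and> (\<forall>i<d. C i \<subset> C (Suc i))}"

text \<open>
  The parameters \<open>n\<close> and \<open>m\<close> are \<open>CARD('n)\<close> and \<open>CARD('m)\<close>; the index set of the tuple
  is \<open>{1..l}\<close>.
\<close>

definition rank_failures ::
  "nat \<Rightarrow> (nat \<Rightarrow> 'a::field ^ 'n \<Rightarrow> 'a ^ 'm) \<Rightarrow> ('a ^ 'n) set \<Rightarrow> nat set" where
  "rank_failures l \<phi> V =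
     {i\<in>{1..l}. zariski_dim (zariski_closure (\<phi> i ` V)) \<noteq> ereal (real CARD('m))}"

definition seeded_rank_extractor_varieties ::
  "nat \<Rightarrow> real \<Rightarrow> nat \<Rightarrow> (nat \<Rightarrow> 'a::field ^ 'n \<Rightarrow> 'a ^ 'm) \<Rightarrow> bool" where
  "seeded_rank_extractor_varieties k \<epsilon> l \<phi> \<longleftrightarrow>
     CARD('m) \<le> CARD('n) \<and> (\<forall>i\<in>{1..l}. polynomial_map (\<phi> i)) \<and>
     (\<forall>V. zariski_closed V \<and> ereal (real k) \<le> zariski_dim V \<longrightarrow>
        real (card (rank_failures l \<phi> V)) \<le> \<epsilon> * real l)"

definition seeded_rank_extractor_subspaces ::
  "nat \<Rightarrow> real \<Rightarrow> nat \<Rightarrow> (nat \<Rightarrow> 'a::field ^ 'n \<Rightarrow> 'a ^ 'm) \<Rightarrow> bool" where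
  "seeded_rank_extractor_subspaces k \<epsilon> l \<phi> \<longleftrightarrow>
     CARD('m) \<le> CARD('n) \<and> (\<forall>i\<in>{1..l}. polynomial_map (\<phi> i)) \<and>
     (\<forall>V. vec.subspace V \<and> k \<le> vec.dim V \<longrightarrow>
        real (card (rank_failures l \<phi> V)) \<le> \<epsilon> * real l)"

definition linear_seeded_rank_extractor_varieties ::
  "nat \<Rightarrow> real \<Rightarrow> nat \<Rightarrow> (nat \<Rightarrow> 'a::field ^ 'n \<Rightarrow> 'a ^ 'm) \<Rightarrow> bool" where
  "linear_seeded_rank_extractor_varieties k \<epsilon> l \<phi> \<longleftrightarrow>
     seeded_rank_extractor_varieties k \<epsilon> l \<phi> \<and> (\<forall>i\<in>{1..l}. linear_polynomial_map (\<phi> i))"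

definition linear_seeded_rank_extractor_subspaces ::
  "nat \<Rightarrow> real \<Rightarrow> nat \<Rightarrow> (nat \<Rightarrow> 'a::field ^ 'n \<Rightarrow> 'a ^ 'm) \<Rightarrow> bool" where
  "linear_seeded_rank_extractor_subspaces k \<epsilon> l \<phi> \<longleftrightarrow>
     seeded_rank_extractor_subspaces k \<epsilon> l \<phi> \<and> (\<forall>i\<in>{1..l}. linear_polynomial_map (\<phi> i))"

end

theory Submission
  imports Defs
begin

text \<open>
  Let \<open>V\<close> be irreducible of dimension \<open>k\<close> (the top of a chain of length \<open>k\<close> in the given variety) and
  let \<open>I\<close> be the set of indices \<open>i\<close> for which \<open>\<phi>\<^sub>i(V)\<close> is not dense. For \<open>i \<in> I\<close> choose a nonzero
  polynomial \<open>G\<^sub>i\<close> of minimal degree vanishing on \<open>\<phi>\<^sub>i(V)\<close>; since the field is perfect, some partial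
  derivative of \<open>G\<^sub>i\<close> does not vanish on \<open>\<phi>\<^sub>i(V)\<close>. At a generic point \<open>a \<in> V\<close>, the space \<open>W\<close> annihilated
  by the gradients of all \<open>G\<^sub>i \<circ> \<phi>\<^sub>i\<close> contains the tangent space of \<open>V\<close>, and \<open>\<phi>\<^sub>i(W)\<close> lies in a
  hyperplane for \<open>i \<in> I\<close>. So every index that fails for \<open>V\<close> fails for the subspace \<open>W\<close>, and it remains to
  show \<open>dim W \<ge> k\<close>.

  If \<open>dim W < k\<close>, some gradients together with fewer than \<open>k\<close> coordinate vectors, indexed by \<open>Z\<close>, form an
  invertible Jacobian matrix at \<open>a\<close>. Writing \<open>F(x) - F(y) = B(x,y)(x - y)\<close> for the corresponding
  functions, \<open>u = det B\<close> satisfies \<open>u(x,y) = 0\<close> for distinct points \<open>x, y\<close> of \<open>V\<close> with the same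
  \<open>Z\<close>-coordinates, while \<open>u(x,x)\<close> is the Jacobian determinant. As \<open>u\<close> is a finite sum of products
  \<open>a(x) b(y)\<close>, only finitely many points of \<open>V\<close> with nonzero Jacobian share their \<open>Z\<close>-coordinates. But
  \<open>V\<close> has transcendence degree at least \<open>k\<close>, so \<open>Z\<close> has infinite generic fibres.
\<close>

section \<open>Roots of polynomials over an infinite field and underdetermined linear
  systems\<close>

text \<open>Over a finite field, one plus the product of all \<open>X - a\<close> would have
  positive degree and no root.\<close>

lemma infinite_UNIV_alg_closed: "infinite (UNIV :: 'a::alg_closed_field set)"
proof
  assume fin: "finite (UNIV :: 'a set)"
  define p :: "'a poly" where "p = (\<Prod>a\<in>UNIV. [:-a, 1:]) + 1"
  have val: "poly p x = 1" for x
    using fin by (simp add: p_def poly_prod prod_zero_iff)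
  have "degree (\<Prod>a\<in>(UNIV :: 'a set). [:-a, 1:]) = card (UNIV :: 'a set)"
    by (subst degree_prod_eq_sum_degree) auto
  moreover have "card (UNIV :: 'a set) > 0"
    using fin by (simp add: card_gt_0_iff)
  ultimately have "degree p > 0"
    unfolding p_def by (subst degree_add_eq_left) auto
  then show False
    using alg_closed_imp_poly_has_root[of p] val by auto
qed

lemma finite_roots_sum:
  fixes a :: "nat \<Rightarrow> 'a::idom"
  assumes "k \<le> d" "a k \<noteq> 0"
  shows "finite {t. (\<Sum>i\<le>d. a i * t ^ i) = 0}"
proof -
  define p where "p = (\<Sum>i\<le>d. monom (a i) i)"
  have "coeff p k = a k"
    using assms by (simp add: p_def coeff_sum)
  then have "p \<noteq> 0"
    using assms by auto
  moreover have "poly p t = (\<Sum>i\<le>d. a i * t ^ i)" for t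
    by (simp add: p_def poly_sum poly_monom)
  ultimately show ?thesis
    using poly_roots_finite[of p] by simp
qed

lemma coeffs_eq_0_if_sum_eq_0:
  fixes a :: "nat \<Rightarrow> 'a::alg_closed_field"
  assumes "\<And>t. (\<Sum>i\<le>d. a i * t ^ i) = 0" "k \<le> d"
  shows "a k = 0"
  using finite_roots_sum[OF assms(2), of a] assms(1) infinite_UNIV_alg_closed by auto

text \<open>Gaussian elimination by induction on the equations: a pivot unknown \<open>p0\<close>
  removes equation \<open>q\<close> and itself. Arbitrary index sets are allowed because unknowns
  are exponent lists in one application and points of a variety in another.\<close>

lemma nontrivial_solution:
  fixes t :: "'p \<Rightarrow> 'q \<Rightarrow> 'a::field"
  assumes "finite Q" "finite P" "card Q < card P"
  shows "\<exists>c. (\<exists>p\<in>P. c p \<noteq> 0) \<and> (\<forall>q\<in>Q. (\<Sum>p\<in>P. c p * t p q) = 0)"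
  using assms
proof (induction Q arbitrary: P t rule: finite_induct)
  case empty
  then obtain p where "p \<in> P"
    by fastforce
  then show ?case
    by (intro exI[of _ "\<lambda>_. 1"]) auto
next
  case (insert q Q)
  show ?case
  proof (cases "\<exists>p0\<in>P. t p0 q \<noteq> 0")
    case False
    have "card Q < card P"
      using insert by auto
    then obtain c where "\<exists>p\<in>P. c p \<noteq> 0" "\<forall>q\<in>Q. (\<Sum>p\<in>P. c p * t p q) = 0"
      using insert.IH insert.prems by blast
    then show ?thesis
      using False by (intro exI[of _ c]) auto
  next
    case True
    then obtain p0 where p0: "p0 \<in> P" "t p0 q \<noteq> 0"
      by blast
    define t' where "t' p r = t p r - t p q / t p0 q * t p0 r" for p r
    have "card Q < card (P - {p0})"
      using insert p0 by simp
    then obtain c where c: "\<exists>p\<in>P - {p0}. c p \<noteq> 0"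
        "\<And>r. r \<in> Q \<Longrightarrow> (\<Sum>p\<in>P - {p0}. c p * t' p r) = 0"
      using insert.IH[of "P - {p0}" t'] insert.prems by blast
    \<comment> \<open>The value at the pivot is the one forced by equation \<open>q\<close>. With
      it, the original system at \<open>c'\<close> agrees with the reduced system \<open>t'\<close>
      at \<open>c\<close>.\<close>
    define c' where "c' = c(p0 := - (\<Sum>p\<in>P - {p0}. c p * (t p q / t p0 q)))"
    have split: "(\<Sum>p\<in>P. c' p * t p r) = (\<Sum>p\<in>P - {p0}. c p * t' p r)" for r
    proof -
      have "(\<Sum>p\<in>P. c' p * t p r) = c' p0 * t p0 r + (\<Sum>p\<in>P - {p0}. c' p * t p r)"
        using p0 insert.prems by (simp add: sum.remove)
      also have "(\<Sum>p\<in>P - {p0}. c' p * t p r) = (\<Sum>p\<in>P - {p0}. c p * t p r)"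
        by (intro sum.cong) (auto simp: c'_def)
      also have "c' p0 * t p0 r = - (\<Sum>p\<in>P - {p0}. c p * (t p q / t p0 q) * t p0 r)"
        by (simp add: c'_def sum_distrib_right)
      finally show ?thesis
        by (simp add: t'_def algebra_simps sum_subtractf)
    qed
    have "(\<Sum>p\<in>P. c' p * t p q) = 0"
      unfolding split using p0 by (simp add: t'_def)
    moreover have "\<exists>p\<in>P. c' p \<noteq> 0"
      using c(1) by (auto simp: c'_def)
    ultimately show ?thesis
      using c(2) split by auto
  qed
qed

section \<open>Algebras of functions and polynomial functions in selected coordinates\<close>

text \<open>Polynomials are treated as functions, which loses nothing over an infinite field.
  Induction over the generation of the algebra then replaces computations with coefficients.\<close>

inductive_set subalg :: "('b \<Rightarrow> 'a::comm_ring_1) set \<Rightarrow> ('b \<Rightarrow> 'a) set" for X where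
  const [intro]: "(\<lambda>_. c) \<in> subalg X"
| gen: "f \<in> X \<Longrightarrow> f \<in> subalg X"
| add [intro]: "f \<in> subalg X \<Longrightarrow> g \<in> subalg X \<Longrightarrow> (\<lambda>x. f x + g x) \<in> subalg X"
| mult [intro]: "f \<in> subalg X \<Longrightarrow> g \<in> subalg X \<Longrightarrow> (\<lambda>x. f x * g x) \<in> subalg X"

lemma subalg_minus [intro]: "f \<in> subalg X \<Longrightarrow> (\<lambda>x. - f x) \<in> subalg X"
  using subalg.mult[OF subalg.const[of "-1"]] by simp

lemma subalg_diff [intro]:
  "f \<in> subalg X \<Longrightarrow> g \<in> subalg X \<Longrightarrow> (\<lambda>x. f x - g x) \<in> subalg X"
  using subalg.add[OF _ subalg_minus, of f X g] by simp

lemma subalg_power [intro]: "f \<in> subalg X \<Longrightarrow> (\<lambda>x. f x ^ i) \<in> subalg X"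
  by (induction i) auto

lemma subalg_sum [intro]:
  "(\<And>i. i \<in> A \<Longrightarrow> f i \<in> subalg X) \<Longrightarrow> (\<lambda>x. \<Sum>i\<in>A. f i x) \<in> subalg X"
  by (induction A rule: infinite_finite_induct) auto

lemma subalg_prod [intro]:
  "(\<And>i. i \<in> A \<Longrightarrow> f i \<in> subalg X) \<Longrightarrow> (\<lambda>x. \<Prod>i\<in>A. f i x) \<in> subalg X"
  by (induction A rule: infinite_finite_induct) auto

lemma subalg_subset:
  assumes "f \<in> subalg X" "X \<subseteq> subalg Y"
  shows "f \<in> subalg Y"
  using assms by (induction rule: subalg.induct) auto

lemma subalg_mono: "f \<in> subalg X \<Longrightarrow> X \<subseteq> Y \<Longrightarrow> f \<in> subalg Y"
  by (erule subalg_subset) (auto intro: subalg.gen)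

lemma subalg_comp:
  assumes "f \<in> subalg X" "\<And>g. g \<in> X \<Longrightarrow> (\<lambda>x. g (\<rho> x)) \<in> subalg Y"
  shows "(\<lambda>x. f (\<rho> x)) \<in> subalg Y"
  using assms by (induction rule: subalg.induct) auto

text \<open>This lets later inductions remove one generator at a time. Powers of \<open>g\<close>
  are collected; in the product case the new coefficients are Cauchy products. Nothing is claimed
  about uniqueness of the coefficients.\<close>

lemma subalg_insert_expand:
  fixes g :: "'b \<Rightarrow> 'a::idom"
  assumes "f \<in> subalg (insert g X)"
  shows "\<exists>d a. (\<forall>i. a i \<in> subalg X) \<and> f = (\<lambda>x. \<Sum>i\<le>d. a i x * g x ^ i)"
  using assms
proof (induction rule: subalg.induct)
  case (const c)
  show ?case
    by (intro exI[of _ "0::nat"] exI[of _ "\<lambda>_ _. c"]) auto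
next
  case (gen f)
  show ?case
  proof (cases "f = g")
    case True
    have *: "(\<lambda>i _. if i = 1 then 1 else 0) i \<in> subalg X" for i :: nat
      by auto
    show ?thesis
      by (intro exI[of _ "1::nat"] exI[of _ "\<lambda>i _. if i = 1 then 1 else 0"] conjI allI *)
        (simp add: True)
  next
    case False
    then have "f \<in> subalg X"
      using gen by (auto intro: subalg.gen)
    then show ?thesis
      by (intro exI[of _ "0::nat"] exI[of _ "\<lambda>_. f"]) auto
  qed
next
  case (add f f')
  then obtain d a d' a' where a: "\<And>i. a i \<in> subalg X" "f = (\<lambda>x. \<Sum>i\<le>d. a i x * g x ^ i)"
    and a': "\<And>i. a' i \<in> subalg X" "f' = (\<lambda>x. \<Sum>i\<le>d'. a' i x * g x ^ i)"
    by blast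
  \<comment> \<open>Both expansions are padded with zero coefficients to the common length
    \<open>d + d'\<close>.\<close>
  define b where "b i x = (if i \<le> d then a i x else 0) + (if i \<le> d' then a' i x else 0)" for i x
  have b: "b i \<in> subalg X" for i
    unfolding b_def by (intro subalg.add) (use a a' in \<open>cases "i \<le> d"; cases "i \<le> d'"; auto\<close>)+
  have ext: "(\<Sum>i\<le>k. c i * t ^ i) = (\<Sum>i\<le>d+d'. (if i \<le> k then c i else 0) * t ^ i)"
    if "k \<le> d + d'" for k c and t :: 'a
    using that by (intro sum.mono_neutral_cong_left) auto
  have "(\<lambda>x. f x + f' x) = (\<lambda>x. \<Sum>i\<le>d+d'. b i x * g x ^ i)"
    unfolding a(2) a'(2) b_def distrib_right sum.distrib
    by (subst ext[of d], simp, subst ext[of d' "\<lambda>i. a' i _"], simp_all)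
  with b show ?case
    by blast
next
  case (mult f f')
  then obtain d a d' a' where a: "\<And>i. a i \<in> subalg X" "f = (\<lambda>x. \<Sum>i\<le>d. a i x * g x ^ i)"
    and a': "\<And>i. a' i \<in> subalg X" "f' = (\<lambda>x. \<Sum>i\<le>d'. a' i x * g x ^ i)"
    by blast
  define b where "b i x = (if i \<le> d then a i x else 0)" for i x
  define b' where "b' i x = (if i \<le> d' then a' i x else 0)" for i x
  have b: "b i \<in> subalg X" "b' i \<in> subalg X" for i
    unfolding b_def b'_def using a a' by (cases "i \<le> d"; cases "i \<le> d'"; auto)+
  have "f x * f' x = (\<Sum>r\<le>d+d'. (\<Sum>k\<le>r. b k x * b' (r - k) x) * g x ^ r)" for x
    using polynomial_product[of d "\<lambda>i. b i x" d' "\<lambda>i. b' i x" "g x"]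
    by (simp add: a(2) a'(2) b_def b'_def)
  moreover have "(\<lambda>x. \<Sum>k\<le>r. b k x * b' (r - k) x) \<in> subalg X" for r
    by (intro subalg_sum subalg.mult b)
  ultimately show ?case
    by (intro exI[of _ "d+d'"] exI[of _ "\<lambda>r x. \<Sum>k\<le>r. b k x * b' (r - k) x"]) auto
qed

definition coord :: "'n \<Rightarrow> 'a ^ 'n \<Rightarrow> 'a" where
  "coord j x = x $ j"

abbreviation polyfun :: "'n set \<Rightarrow> ('a::comm_ring_1 ^ 'n \<Rightarrow> 'a) set" where
  "polyfun T \<equiv> subalg (coord ` T)"

lemma coord_polyfun [intro]: "j \<in> T \<Longrightarrow> coord j \<in> polyfun T"
  by (auto intro: subalg.gen)

lemma nth_polyfun [intro]: "j \<in> T \<Longrightarrow> (\<lambda>x. x $ j) \<in> polyfun T"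
  using coord_polyfun[of j T] by (simp add: coord_def[abs_def])

lemma polyfun_mono: "f \<in> polyfun T \<Longrightarrow> T \<subseteq> T' \<Longrightarrow> f \<in> polyfun T'"
  by (erule subalg_mono) auto

lemma polyfun_UNIV: "f \<in> polyfun T \<Longrightarrow> f \<in> polyfun UNIV"
  by (erule polyfun_mono) auto

lemma polyfun_cong:
  assumes "f \<in> polyfun T" "\<And>j. j \<in> T \<Longrightarrow> x $ j = y $ j"
  shows "f x = f y"
  using assms by (induction rule: subalg.induct) (auto simp: coord_def)

definition vupd :: "'a ^ 'n \<Rightarrow> 'n \<Rightarrow> 'a \<Rightarrow> 'a ^ 'n" where
  "vupd x j t = (\<chi> i. if i = j then t else x $ i)"

lemma vupd_nth [simp]: "vupd x j t $ i = (if i = j then t else x $ i)"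
  by (simp add: vupd_def)

lemma polyfun_vupd: "f \<in> polyfun T \<Longrightarrow> j \<notin> T \<Longrightarrow> f (vupd x j t) = f x"
  by (rule polyfun_cong[of f T]) auto

lemma polyfun_insert_expand:
  fixes f :: "'a::idom ^ 'n \<Rightarrow> 'a"
  assumes "f \<in> polyfun (insert j T)"
  obtains d a where "\<And>i. a i \<in> polyfun T" "f = (\<lambda>x. \<Sum>i\<le>d. a i x * x $ j ^ i)"
  using subalg_insert_expand[of f "coord j" "coord ` T"] assms
  by (force simp: coord_def)

text \<open>The coefficients do not depend on coordinate \<open>j\<close>. So at a fixed
  \<open>x\<close> that coordinate can run through the whole infinite field, and a polynomial in one
  variable vanishes everywhere.\<close>

lemma polyfun_coeffs_eq_0:
  fixes a :: "nat \<Rightarrow> 'a::alg_closed_field ^ 'n \<Rightarrow> 'a"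
  assumes "\<And>i. a i \<in> polyfun T" "j \<notin> T" "\<And>x. (\<Sum>i\<le>d. a i x * x $ j ^ i) = 0" "k \<le> d"
  shows "a k x = 0"
proof (rule coeffs_eq_0_if_sum_eq_0[where a = "\<lambda>i. a i x"])
  show "(\<Sum>i\<le>d. a i x * t ^ i) = 0" for t
    using assms(3)[of "vupd x j t"] by (simp add: polyfun_vupd[OF assms(1,2)])
qed fact

text \<open>Polynomial functions form an integral domain. If neither factor is zero, each has a
  nonzero coefficient with respect to one variable; by induction two such coefficients are nonzero
  at a common point \<open>z\<close>, and the removed variable can then avoid finitely many
  roots.\<close>

lemma polyfun_mult_eq_0:
  fixes f g :: "'a::alg_closed_field ^ 'n \<Rightarrow> 'a"
  assumes "f \<in> polyfun T" "g \<in> polyfun T" "\<And>x. f x * g x = 0"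
  shows "(\<forall>x. f x = 0) \<or> (\<forall>x. g x = 0)"
proof -
  have "finite T"
    by simp
  then show ?thesis
    using assms
  proof (induction T arbitrary: f g rule: finite_induct)
    case empty
    have "f x = f 0" "g x = g 0" for x
      using empty polyfun_cong[of f "{}" x 0] polyfun_cong[of g "{}" x 0] by auto
    then show ?case
      by (metis empty.prems(3) mult_eq_0_iff)
  next
    case (insert j T)
    obtain d a where a: "\<And>i. a i \<in> polyfun T" "f = (\<lambda>x. \<Sum>i\<le>d. a i x * x $ j ^ i)"
      using insert.prems(1) polyfun_insert_expand by blast
    obtain e b where b: "\<And>i. b i \<in> polyfun T" "g = (\<lambda>x. \<Sum>i\<le>e. b i x * x $ j ^ i)"
      using insert.prems(2) polyfun_insert_expand by blast
    show ?case
    proof (rule ccontr)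
      assume "\<not> ?thesis"
      then obtain x y where "f x \<noteq> 0" "g y \<noteq> 0"
        by blast
      then obtain k l where kl: "k \<le> d" "a k x \<noteq> 0" "l \<le> e" "b l y \<noteq> 0"
        unfolding a(2) b(2) by (metis (no_types, lifting) atMost_iff mult_not_zero sum.neutral)
      then obtain z where z: "a k z \<noteq> 0" "b l z \<noteq> 0"
        using insert.IH[OF a(1)[of k] b(1)[of l]] by auto
      have "finite {t. (\<Sum>i\<le>d. a i z * t ^ i) = 0}" "finite {t. (\<Sum>i\<le>e. b i z * t ^ i) = 0}"
        using finite_roots_sum[of k d "\<lambda>i. a i z"] finite_roots_sum[of l e "\<lambda>i. b i z"] kl z by auto
      then obtain t where t: "(\<Sum>i\<le>d. a i z * t ^ i) \<noteq> 0" "(\<Sum>i\<le>e. b i z * t ^ i) \<noteq> 0"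
        using ex_new_if_finite[OF infinite_UNIV_alg_closed,
            of "{t. (\<Sum>i\<le>d. a i z * t ^ i) = 0} \<union> {t. (\<Sum>i\<le>e. b i z * t ^ i) = 0}"] by auto
      have "f (vupd z j t) * g (vupd z j t) \<noteq> 0"
        using t by (simp add: a(2) b(2) polyfun_vupd[OF a(1) insert.hyps(2)]
            polyfun_vupd[OF b(1) insert.hyps(2)])
      then show False
        using insert.prems(3) by blast
    qed
  qed
qed

section \<open>Polynomial functions and Zariski-closed sets\<close>

definition mono_fun :: "('n::finite \<Rightarrow> nat) \<Rightarrow> 'a::comm_ring_1 ^ 'n \<Rightarrow> 'a" where
  "mono_fun e x = (\<Prod>j\<in>UNIV. (x $ j) ^ e j)"

lemma mono_fun_0 [simp]: "mono_fun (\<lambda>_. 0) x = 1"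
  by (simp add: mono_fun_def)

lemma mono_fun_add: "mono_fun (\<lambda>j. e j + e' j) x = mono_fun e x * mono_fun e' x"
  by (simp add: mono_fun_def power_add prod.distrib)

lemma mono_fun_split: "mono_fun e x = (x $ j) ^ e j * mono_fun (e(j := 0)) x"
proof -
  have "mono_fun e x = (x $ j) ^ e j * (\<Prod>i\<in>UNIV - {j}. (x $ i) ^ e i)"
    by (simp add: mono_fun_def prod.remove[of _ j])
  moreover have "mono_fun (e(j := 0)) x = (\<Prod>i\<in>UNIV - {j}. (x $ i) ^ e i)"
    by (simp add: mono_fun_def prod.remove[of _ j])
  ultimately show ?thesis
    by simp
qed

lemma mono_fun_polyfun: "(\<And>j. j \<notin> T \<Longrightarrow> e j = 0) \<Longrightarrow> mono_fun e \<in> polyfun T"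
proof -
  assume *: "\<And>j. j \<notin> T \<Longrightarrow> e j = 0"
  have "(\<lambda>x. (x $ j) ^ e j) \<in> polyfun T" for j
  proof (cases "j \<in> T")
    case True
    then show ?thesis
      by (intro subalg_power nth_polyfun)
  next
    case False
    then show ?thesis
      using * by auto
  qed
  then show ?thesis
    unfolding mono_fun_def[abs_def] by (intro subalg_prod)
qed

lemma mvpoly_eval_superset:
  assumes "finite A" "Poly_Mapping.keys p \<subseteq> A"
  shows "mvpoly_eval p x = (\<Sum>e\<in>A. Poly_Mapping.lookup p e * mono_fun (Poly_Mapping.lookup e) x)"
  unfolding mvpoly_eval_def mono_fun_def using assms
  by (intro sum.mono_neutral_left) (auto simp: in_keys_iff)

lemma mvpoly_eval_add: "mvpoly_eval (p + q) x = mvpoly_eval p x + mvpoly_eval q x"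
  using Poly_Mapping.keys_add[of p q]
  by (simp add: mvpoly_eval_superset[of "Poly_Mapping.keys p \<union> Poly_Mapping.keys q"]
      lookup_add distrib_right sum.distrib)

lemma mvpoly_eval_0: "mvpoly_eval 0 x = 0"
  by (simp add: mvpoly_eval_def)

lemma mvpoly_eval_sum: "mvpoly_eval (\<Sum>i\<in>A. p i) x = (\<Sum>i\<in>A. mvpoly_eval (p i) x)"
  by (induction A rule: infinite_finite_induct) (simp_all add: mvpoly_eval_0 mvpoly_eval_add)

lemma mvpoly_eval_single:
  "mvpoly_eval (Poly_Mapping.single e c) x = c * mono_fun (Poly_Mapping.lookup e) x"
  by (simp add: mvpoly_eval_superset[of "{e}"])

lemma mvpoly_eval_polyfun: "mvpoly_eval p \<in> polyfun UNIV"
  unfolding mvpoly_eval_def[abs_def]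
  by (intro subalg_sum subalg.mult subalg.const subalg_prod subalg_power nth_polyfun UNIV_I)

text \<open>With \<open>mvpoly_eval_polyfun\<close> this identifies \<open>polyfun UNIV\<close> with
  the evaluations of formal polynomials, so that \<open>zariski_closed_iff\<close> can dispense with
  the formal ones.\<close>

lemma polyfun_imp_mvpoly_eval:
  assumes "f \<in> polyfun UNIV"
  shows "\<exists>p. f = mvpoly_eval p"
  using assms
proof (induction rule: subalg.induct)
  case (const c)
  have "(\<lambda>_. c) = mvpoly_eval (Poly_Mapping.single 0 c)"
    by (auto simp: mvpoly_eval_single zero_poly_mapping.rep_eq mono_fun_def)
  then show ?case
    by blast
next
  case (gen f)
  then obtain j where j: "f = coord j"
    by auto
  have "mono_fun (Poly_Mapping.lookup (Poly_Mapping.single j 1)) x = x $ j" for x :: "'a ^ 'b"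
    unfolding mono_fun_def by (subst prod.remove[of _ j]) (auto simp: lookup_single when_def)
  then have "f = mvpoly_eval (Poly_Mapping.single (Poly_Mapping.single j 1) 1)"
    by (auto simp: j coord_def mvpoly_eval_single)
  then show ?case
    by blast
next
  case (add f g)
  then obtain p q where "f = mvpoly_eval p" "g = mvpoly_eval q"
    by blast
  then have "(\<lambda>x. f x + g x) = mvpoly_eval (p + q)"
    by (simp add: mvpoly_eval_add fun_eq_iff)
  then show ?case
    by blast
next
  case (mult f g)
  then obtain p q where pq: "f = mvpoly_eval p" "g = mvpoly_eval q"
    by blast
  define r where "r = (\<Sum>e\<in>Poly_Mapping.keys p. \<Sum>e'\<in>Poly_Mapping.keys q.
    Poly_Mapping.single (e + e') (Poly_Mapping.lookup p e * Poly_Mapping.lookup q e'))"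
  have "(\<lambda>x. f x * g x) = mvpoly_eval r"
    unfolding r_def mvpoly_eval_sum mvpoly_eval_single fun_eq_iff
    by (simp add: pq mvpoly_eval_superset[OF finite_keys order_refl]
        plus_poly_mapping.rep_eq mono_fun_add sum_product mult_ac)
  then show ?case
    by blast
qed

lemma zariski_closed_iff:
  "zariski_closed V \<longleftrightarrow> (\<exists>S \<subseteq> polyfun UNIV. V = {x. \<forall>f\<in>S. f x = 0})"
proof
  assume "zariski_closed V"
  then obtain S where "V = {x. \<forall>p\<in>S. mvpoly_eval p x = 0}"
    by (auto simp: zariski_closed_def)
  then show "\<exists>S \<subseteq> polyfun UNIV. V = {x. \<forall>f\<in>S. f x = 0}"
    by (intro exI[of _ "mvpoly_eval ` S"]) (auto simp: mvpoly_eval_polyfun)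
next
  assume "\<exists>S \<subseteq> polyfun UNIV. V = {x. \<forall>f\<in>S. f x = 0}"
  then obtain S where S: "S \<subseteq> polyfun UNIV" "V = {x. \<forall>f\<in>S. f x = 0}"
    by blast
  define P where "P = {p. mvpoly_eval p \<in> S}"
  have "mvpoly_eval ` P = S"
    unfolding P_def using S(1) polyfun_imp_mvpoly_eval by blast
  then have "V = {x. \<forall>p\<in>P. mvpoly_eval p x = 0}"
    unfolding S(2) by blast
  then show "zariski_closed V"
    by (auto simp: zariski_closed_def)
qed

lemma zariski_closed_Int_zeros:
  assumes "zariski_closed V" "f \<in> polyfun UNIV"
  shows "zariski_closed {x\<in>V. f x = 0}"
proof -
  obtain S where S: "S \<subseteq> polyfun UNIV" "V = {x. \<forall>f\<in>S. f x = 0}"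
    using assms(1) by (auto simp: zariski_closed_iff)
  show ?thesis
    unfolding zariski_closed_iff using S assms(2) by (intro exI[of _ "insert f S"]) auto
qed

lemma zariski_closed_zeros:
  "f \<in> polyfun UNIV \<Longrightarrow> zariski_closed {x. f x = 0}"
  unfolding zariski_closed_iff by (intro exI[of _ "{f}"]) auto

lemma zariski_closed_separation:
  assumes "zariski_closed V" "x \<notin> V"
  obtains f where "f \<in> polyfun UNIV" "\<And>y. y \<in> V \<Longrightarrow> f y = 0" "f x \<noteq> 0"
  using assms by (auto simp: zariski_closed_iff)

text \<open>Expresses that the ideal of functions vanishing on \<open>V\<close> is prime. It is
  separated from closedness because most arguments below only cancel factors on
  \<open>V\<close>.\<close>

definition prime_set :: "('a::field ^ 'n) set \<Rightarrow> bool" where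
  "prime_set V \<longleftrightarrow> V \<noteq> {} \<and>
     (\<forall>f\<in>polyfun UNIV. \<forall>g\<in>polyfun UNIV. (\<forall>x\<in>V. f x * g x = 0) \<longrightarrow>
        (\<forall>x\<in>V. f x = 0) \<or> (\<forall>x\<in>V. g x = 0))"

text \<open>A product vanishing on \<open>V\<close> splits \<open>V\<close> into two zero sets.
  Conversely, functions separating a point of \<open>V\<close> from \<open>A\<close> and another
  from \<open>B\<close> have a product that vanishes on the union.\<close>

lemma zariski_irreducible_iff:
  "zariski_irreducible V \<longleftrightarrow> zariski_closed V \<and> prime_set V"
proof (intro iffI conjI)
  assume V: "zariski_irreducible V"
  then show cl: "zariski_closed V"
    by (simp add: zariski_irreducible_def)
  show "prime_set V"
    unfolding prime_set_def
  proof (intro conjI ballI impI)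
    show "V \<noteq> {}"
      using V by (simp add: zariski_irreducible_def)
    fix f g :: "'a ^ 'b \<Rightarrow> 'a"
    assume fg: "f \<in> polyfun UNIV" "g \<in> polyfun UNIV" "\<forall>x\<in>V. f x * g x = 0"
    have "V = {x\<in>V. f x = 0} \<union> {x\<in>V. g x = 0}"
      using fg(3) by auto
    then have "V = {x\<in>V. f x = 0} \<or> V = {x\<in>V. g x = 0}"
      using V zariski_closed_Int_zeros[OF cl] fg(1,2) unfolding zariski_irreducible_def by blast
    then show "(\<forall>x\<in>V. f x = 0) \<or> (\<forall>x\<in>V. g x = 0)"
      by blast
  qed
next
  assume V: "zariski_closed V \<and> prime_set V"
  show "zariski_irreducible V"
    unfolding zariski_irreducible_def
  proof (intro conjI allI impI)
    fix A B assume AB: "zariski_closed A \<and> zariski_closed B \<and> V = A \<union> B"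
    show "V = A \<or> V = B"
    proof (rule ccontr)
      assume "\<not> ?thesis"
      then obtain a b where ab: "a \<in> V" "a \<notin> A" "b \<in> V" "b \<notin> B"
        using AB by blast
      obtain f where f: "f \<in> polyfun UNIV" "\<And>y. y \<in> A \<Longrightarrow> f y = 0" "f a \<noteq> 0"
        using zariski_closed_separation AB ab(2) by metis
      obtain g where g: "g \<in> polyfun UNIV" "\<And>y. y \<in> B \<Longrightarrow> g y = 0" "g b \<noteq> 0"
        using zariski_closed_separation AB ab(4) by metis
      have "\<forall>x\<in>V. f x * g x = 0"
        using AB f(2) g(2) by auto
      then show False
        using V f g ab unfolding prime_set_def by blast
    qed
  qed (use V in \<open>auto simp: prime_set_def\<close>)
qed

lemma prime_setD:
  assumes "prime_set V" "f \<in> polyfun UNIV" "g \<in> polyfun UNIV" "\<And>x. x \<in> V \<Longrightarrow> f x * g x = 0"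
    "a \<in> V" "f a \<noteq> 0" "x \<in> V"
  shows "g x = 0"
  using assms unfolding prime_set_def by blast

text \<open>Finitely many generic conditions hold at a common point, as nonempty open subsets of an
  irreducible set meet.\<close>

lemma prime_set_prod:
  assumes "prime_set V" "finite A" "\<And>i. i \<in> A \<Longrightarrow> f i \<in> polyfun UNIV"
    "\<And>i. i \<in> A \<Longrightarrow> \<exists>x\<in>V. f i x \<noteq> 0"
  shows "\<exists>x\<in>V. (\<Prod>i\<in>A. f i x) \<noteq> 0"
  using assms(2-)
proof (induction A rule: finite_induct)
  case empty
  then show ?case
    using assms(1) by (auto simp: prime_set_def)
next
  case (insert i A)
  have "(\<lambda>x. \<Prod>i\<in>A. f i x) \<in> polyfun UNIV"
    using insert.prems by (intro subalg_prod) auto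
  moreover have "f i \<in> polyfun UNIV" "\<exists>x\<in>V. f i x \<noteq> 0" "\<exists>x\<in>V. (\<Prod>i\<in>A. f i x) \<noteq> 0"
    using insert by auto
  ultimately have "\<exists>x\<in>V. f i x * (\<Prod>i\<in>A. f i x) \<noteq> 0"
    using prime_setD[OF assms(1), of "f i" "\<lambda>x. \<Prod>i\<in>A. f i x"] by blast
  then show ?case
    using insert.hyps by simp
qed

lemma prime_set_power:
  assumes "prime_set V" "q \<in> polyfun UNIV" "a \<in> V" "q a \<noteq> 0" "g \<in> polyfun UNIV"
    "\<And>x. x \<in> V \<Longrightarrow> q x ^ n * g x = 0" "x \<in> V"
  shows "g x = 0"
  by (rule prime_setD[of V "\<lambda>x. q x ^ n" g a]) (use assms in \<open>auto\<close>)

text \<open>Pulling back along \<open>\<rho>\<close> turns a product vanishing on \<open>V\<close>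
  into one vanishing on the whole space, where \<open>polyfun_mult_eq_0\<close> applies.\<close>

lemma prime_set_retract:
  fixes \<rho> :: "'a::alg_closed_field ^ 'n \<Rightarrow> 'a ^ 'n"
  assumes "\<And>j. (\<lambda>x. \<rho> x $ j) \<in> polyfun UNIV" "\<rho> ` UNIV = V"
  shows "prime_set V"
  unfolding prime_set_def
proof (intro conjI ballI impI)
  show "V \<noteq> {}"
    using assms(2) by auto
  fix f g :: "'a ^ 'n \<Rightarrow> 'a"
  assume fg: "f \<in> polyfun UNIV" "g \<in> polyfun UNIV" "\<forall>x\<in>V. f x * g x = 0"
  have "(\<lambda>x. f (\<rho> x)) \<in> polyfun UNIV" "(\<lambda>x. g (\<rho> x)) \<in> polyfun UNIV"
    by (rule subalg_comp[OF fg(1)], use assms(1) in \<open>auto simp: coord_def\<close>)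
      (rule subalg_comp[OF fg(2)], use assms(1) in \<open>auto simp: coord_def\<close>)
  from polyfun_mult_eq_0[OF this] fg(3) assms(2) show "(\<forall>x\<in>V. f x = 0) \<or> (\<forall>x\<in>V. g x = 0)"
    by blast
qed

lemma zariski_irreducible_UNIV: "zariski_irreducible (UNIV :: ('a::alg_closed_field ^ 'n) set)"
  unfolding zariski_irreducible_iff zariski_closed_iff
proof
  show "prime_set (UNIV :: ('a ^ 'n) set)"
    by (rule prime_set_retract[of id]) auto
qed auto

section \<open>Algebraic independence and transcendence degree\<close>

text \<open>Transcendence in the ring of functions restricted to \<open>V\<close>: both the relation
  and the vanishing of its coefficients are tested on \<open>V\<close> only.\<close>

definition transcendental_over ::
    "('b \<Rightarrow> 'a::field) set \<Rightarrow> 'b set \<Rightarrow> ('b \<Rightarrow> 'a) \<Rightarrow> bool" where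
  "transcendental_over A V f \<longleftrightarrow>
     (\<forall>d a. (\<forall>i. a i \<in> A) \<longrightarrow> (\<forall>x\<in>V. (\<Sum>i\<le>d. a i x * f x ^ i) = 0) \<longrightarrow>
        (\<forall>i\<le>d. \<forall>x\<in>V. a i x = 0))"

text \<open>A tower of transcendence conditions suits chains of varieties, where each inclusion adds
  one function on top. The joint form, linear independence of monomials, is
  \<open>alg_indep_imp_mono_list_indep\<close>.\<close>

fun alg_indep :: "'b set \<Rightarrow> ('b \<Rightarrow> 'a::field) list \<Rightarrow> bool" where
  "alg_indep V [] \<longleftrightarrow> True"
| "alg_indep V (f # fs) \<longleftrightarrow> transcendental_over (subalg (set fs)) V f \<and> alg_indep V fs"

fun mono_list :: "('b \<Rightarrow> 'a::field) list \<Rightarrow> nat list \<Rightarrow> 'b \<Rightarrow> 'a" where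
  "mono_list (f # fs) (e # es) x = f x ^ e * mono_list fs es x"
| "mono_list _ _ x = 1"

definition exponents :: "nat \<Rightarrow> nat \<Rightarrow> nat list set" where
  "exponents d k = {es. set es \<subseteq> {..d} \<and> length es = k}"

lemma finite_exponents: "finite (exponents d k)"
  unfolding exponents_def by (rule finite_lists_length_eq) simp

lemma card_exponents: "card (exponents d k) = (d + 1) ^ k"
  unfolding exponents_def by (simp add: card_lists_length_eq)

lemma exponents_Suc: "exponents d (Suc k) = (\<lambda>(e, es). e # es) ` ({..d} \<times> exponents d k)"
  by (force simp: exponents_def length_Suc_conv)

lemma mono_list_subalg: "mono_list fs es \<in> subalg (set fs)"
proof (induction fs es rule: list_induct2')
  case (4 f fs e es)
  have "mono_list fs es \<in> subalg (set (f # fs))"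
    by (rule subalg_mono[OF 4]) auto
  moreover have "f \<in> subalg (set (f # fs))"
    by (rule subalg.gen) simp
  ultimately show ?case
    by (simp del: set_simps add: subalg.mult subalg_power)
qed auto

lemma transcendental_overD:
  "transcendental_over A V f \<Longrightarrow> (\<And>i. a i \<in> A) \<Longrightarrow>
    (\<And>x. x \<in> V \<Longrightarrow> (\<Sum>i\<le>d. a i x * f x ^ i) = 0) \<Longrightarrow> i \<le> d \<Longrightarrow> x \<in> V \<Longrightarrow> a i x = 0"
  unfolding transcendental_over_def by blast

text \<open>Grouping the monomials by the exponent of the first function gives a relation for it
  over the algebra of the others. Transcendence makes the grouped coefficients vanish on
  \<open>V\<close>, and the induction hypothesis applies to each of them.\<close>

lemma alg_indep_imp_mono_list_indep:
  assumes "alg_indep V fs" "V \<noteq> {}"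
    and "\<And>x. x \<in> V \<Longrightarrow> (\<Sum>es\<in>exponents d (length fs). c es * mono_list fs es x) = 0"
    and "es \<in> exponents d (length fs)"
  shows "c es = 0"
  using assms(1,3,4)
proof (induction fs arbitrary: c es)
  case Nil
  have "exponents d 0 = {[]}"
    by (auto simp: exponents_def)
  then show ?case
    using Nil assms(2) by auto
next
  case (Cons f fs)
  define a where "a i x = (\<Sum>es\<in>exponents d (length fs). c (i # es) * mono_list fs es x)" for i x
  have a: "a i \<in> subalg (set fs)" for i
    unfolding a_def by (intro subalg_sum subalg.mult subalg.const mono_list_subalg)
  have inj: "inj_on (\<lambda>(e, es). e # es) ({..d} \<times> exponents d (length fs))"
    by (auto simp: inj_on_def)
  have "(\<Sum>i\<le>d. a i x * f x ^ i) = 0" if "x \<in> V" for x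
  proof -
    have "0 = (\<Sum>(e, es)\<in>{..d} \<times> exponents d (length fs). c (e # es) * (f x ^ e * mono_list fs es x))"
      using Cons.prems(2)[OF that] unfolding length_Cons exponents_Suc sum.reindex[OF inj]
      by (simp add: case_prod_beta)
    also have "\<dots> = (\<Sum>i\<le>d. a i x * f x ^ i)"
      by (simp add: a_def sum.cartesian_product[symmetric] sum_distrib_right sum_distrib_left mult_ac)
    finally show ?thesis
      by simp
  qed
  then have a0: "a i x = 0" if "i \<le> d" "x \<in> V" for i x
    using transcendental_overD[of "subalg (set fs)" V f a d i x] Cons.prems(1) a that by simp
  obtain i es' where es: "es = i # es'" "i \<le> d" "es' \<in> exponents d (length fs)"
    using Cons.prems(3) by (auto simp: exponents_Suc)
  show ?case
    using Cons.IH[of "\<lambda>es. c (i # es)" es'] Cons.prems(1) a0[OF es(2)] es by (auto simp: a_def)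
qed

text \<open>Equivalently, the projection of \<open>V\<close> to the coordinates in \<open>S\<close>
  is Zariski dense.\<close>

definition coords_indep :: "('a::field ^ 'n) set \<Rightarrow> 'n set \<Rightarrow> bool" where
  "coords_indep V S \<longleftrightarrow> (\<forall>f\<in>polyfun S. (\<forall>x\<in>V. f x = 0) \<longrightarrow> (\<forall>x. f x = 0))"

lemma coords_indepD:
  "coords_indep V S \<Longrightarrow> f \<in> polyfun S \<Longrightarrow> (\<And>x. x \<in> V \<Longrightarrow> f x = 0) \<Longrightarrow> f x = 0"
  unfolding coords_indep_def by simp

lemma coords_indep_subset: "coords_indep V S \<Longrightarrow> T \<subseteq> S \<Longrightarrow> coords_indep V T"
  unfolding coords_indep_def using polyfun_mono by blast

lemma coords_indep_empty: "V \<noteq> {} \<Longrightarrow> coords_indep V {}"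
  unfolding coords_indep_def
proof (intro ballI impI allI)
  fix f :: "'a ^ 'b \<Rightarrow> 'a" and x assume f: "f \<in> polyfun {}" "\<forall>x\<in>V. f x = 0" and "V \<noteq> {}"
  then obtain y where "y \<in> V"
    by blast
  then show "f x = 0"
    using f polyfun_cong[OF f(1), of x y] by simp
qed

text \<open>Expand a nonzero function that vanishes on \<open>V\<close> in powers of coordinate
  \<open>j\<close>. Independence of \<open>S\<close> keeps the leading coefficient nonzero on
  \<open>V\<close>; in degree zero that coefficient would itself be the vanishing function.\<close>

lemma coords_dependent_relation:
  fixes V :: "('a::alg_closed_field ^ 'n) set"
  assumes "coords_indep V S" "\<not> coords_indep V (insert j S)"
  obtains e a where "\<And>i. a i \<in> polyfun S" "\<exists>x\<in>V. a e x \<noteq> 0" "e > 0"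
    "\<And>x. x \<in> V \<Longrightarrow> (\<Sum>i\<le>e. a i x * x $ j ^ i) = 0"
proof -
  obtain f y where f: "f \<in> polyfun (insert j S)" "\<And>x. x \<in> V \<Longrightarrow> f x = 0" "f y \<noteq> 0"
    using assms(2) by (auto simp: coords_indep_def)
  obtain d a where a: "\<And>i. a i \<in> polyfun S" "f = (\<lambda>x. \<Sum>i\<le>d. a i x * x $ j ^ i)"
    using f(1) polyfun_insert_expand by blast
  \<comment> \<open>Coefficients that vanish identically are trimmed so that the last one, with
    index \<open>e\<close>, is a true leading coefficient.\<close>
  define I where "I = {i. i \<le> d \<and> (\<exists>x. a i x \<noteq> 0)}"
  have "I \<noteq> {}"
    using f(3) unfolding I_def a(2) by (auto dest: sum.not_neutral_contains_not_neutral)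
  define e where "e = Max I"
  have fin: "finite I"
    by (simp add: I_def)
  have e: "e \<in> I" and e_max: "\<And>i. i \<in> I \<Longrightarrow> i \<le> e"
    using Max_in[OF fin \<open>I \<noteq> {}\<close>] Max_ge[OF fin] by (auto simp: e_def)
  have f_eq: "f x = (\<Sum>i\<le>e. a i x * x $ j ^ i)" for x
    unfolding a(2) using e e_max by (intro sum.mono_neutral_right) (force simp: I_def)+
  have ne: "\<exists>x\<in>V. a e x \<noteq> 0"
    using e assms(1) a(1)[of e] unfolding coords_indep_def I_def by blast
  moreover have "e > 0"
  proof (rule ccontr)
    assume "\<not> e > 0"
    then show False
      using ne f(2) f_eq by auto
  qed
  ultimately show ?thesis
    using that[where a = a, OF a(1), of e] f(2) f_eq by simp
qed

lemma coords_indep_imp_alg_indep: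
  fixes V :: "('a::alg_closed_field ^ 'n) set"
  assumes "coords_indep V (set js)" "distinct js"
  shows "alg_indep V (map coord js)"
  using assms
proof (induction js)
  case (Cons j js)
  have "transcendental_over (polyfun (set js)) V (coord j)"
    unfolding transcendental_over_def
  proof (intro allI impI)
    fix d i and a :: "nat \<Rightarrow> 'a ^ 'n \<Rightarrow> 'a"
    assume a: "\<forall>i. a i \<in> polyfun (set js)" "\<forall>x\<in>V. (\<Sum>i\<le>d. a i x * coord j x ^ i) = 0" "i \<le> d"
    have "a i \<in> polyfun (set (j # js))" for i
      using polyfun_mono[of "a i" "set js" "set (j # js)"] a(1) by auto
    moreover have "coord j \<in> polyfun (set (j # js))"
      by (rule coord_polyfun) simp
    ultimately have "(\<lambda>x. \<Sum>i\<le>d. a i x * coord j x ^ i) \<in> polyfun (set (j # js))"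
      by (intro subalg_sum subalg.mult subalg_power)
    then have "(\<Sum>i\<le>d. a i x * coord j x ^ i) = 0" for x
      using coords_indepD[OF Cons.prems(1), of "\<lambda>x. \<Sum>i\<le>d. a i x * coord j x ^ i"] a(2) by blast
    then show "\<forall>x\<in>V. a i x = 0"
      using polyfun_coeffs_eq_0[of a "set js" j d i] a Cons.prems(2) by (auto simp: coord_def)
  qed
  moreover have "coords_indep V (set js)"
    using Cons.prems(1) by (rule coords_indep_subset) auto
  ultimately show ?case
    using Cons by (simp add: list.set_map[symmetric] del: set_map)
qed simp

section \<open>Bounding the number of independent functions by counting monomials\<close>

text \<open>After inverting the common denominator \<open>q\<close>, every remaining coordinate is
  integral over the coordinates in \<open>S\<close>, with one common degree \<open>E\<close>. The
  coordinate ring of \<open>V\<close> is then a finite module over its base.\<close>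

locale finite_over_coords =
  fixes V :: "('a::alg_closed_field ^ 'n) set" and S :: "'n set" and q :: "'a ^ 'n \<Rightarrow> 'a" and E :: nat
  assumes prime: "prime_set V"
    and q: "q \<in> polyfun S" "\<exists>x\<in>V. q x \<noteq> 0"
    and E: "E > 0"
    and rel: "\<And>j. j \<notin> S \<Longrightarrow> \<exists>a. (\<forall>i. a i \<in> polyfun S) \<and>
               (\<forall>x\<in>V. q x * x $ j ^ E = (\<Sum>i<E. a i x * x $ j ^ i))"
begin

text \<open>Reduction by \<open>rel\<close> keeps the exponents outside \<open>S\<close> below
  \<open>E\<close>, so only exponents in \<open>S\<close> grow with \<open>D\<close>. The size of
  the box is of order \<open>D\<close> to the power \<open>card S\<close>, which drives the count in
  \<open>length_alg_indep_le\<close>.\<close>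

definition expbox :: "nat \<Rightarrow> ('n \<Rightarrow> nat) set" where
  "expbox D = PiE UNIV (\<lambda>j. {..<if j \<in> S then D + 1 else E})"

lemma finite_expbox: "finite (expbox D)"
  by (simp add: expbox_def finite_PiE)

lemma card_expbox: "card (expbox D) = (D + 1) ^ card S * E ^ card (- S)"
  by (simp add: expbox_def card_PiE if_distrib[of card] prod.If_cases Collect_neg_eq)

lemma expboxI: "(\<And>j. j \<in> S \<Longrightarrow> e j \<le> D) \<Longrightarrow> (\<And>j. j \<notin> S \<Longrightarrow> e j < E) \<Longrightarrow> e \<in> expbox D"
  by (auto simp: expbox_def PiE_iff less_Suc_eq_le)

lemma expboxD:
  assumes "e \<in> expbox D"
  shows "j \<in> S \<Longrightarrow> e j \<le> D" "j \<notin> S \<Longrightarrow> e j < E"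
  using PiE_mem[OF assms[unfolded expbox_def], of j] by auto

definition box_span :: "nat \<Rightarrow> ('a ^ 'n \<Rightarrow> 'a) \<Rightarrow> bool" where
  "box_span D f \<longleftrightarrow> (\<exists>c. \<forall>x\<in>V. f x = (\<Sum>e\<in>expbox D. c e * mono_fun e x))"

lemma box_span_cong: "box_span D f \<Longrightarrow> (\<And>x. x \<in> V \<Longrightarrow> g x = f x) \<Longrightarrow> box_span D g"
  by (auto simp: box_span_def)

lemma box_span_mono_fun: "e \<in> expbox D \<Longrightarrow> box_span D (mono_fun e)"
proof -
  assume e: "e \<in> expbox D"
  have "mono_fun e x = (\<Sum>e'\<in>expbox D. (if e' = e then 1 else 0) * mono_fun e' x)" for x :: "'a ^ 'n"
    using e by (simp add: finite_expbox if_distrib[of "\<lambda>c. c * _"] cong: if_cong)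
  then show ?thesis
    unfolding box_span_def by (intro exI[of _ "\<lambda>e'. if e' = e then 1 else 0"]) blast
qed

lemma box_span_0: "box_span D (\<lambda>_. 0)"
  unfolding box_span_def by (intro exI[of _ "\<lambda>_. 0"]) simp

lemma box_span_add: "box_span D f \<Longrightarrow> box_span D g \<Longrightarrow> box_span D (\<lambda>x. f x + g x)"
  unfolding box_span_def
proof (elim exE)
  fix c c' assume "\<forall>x\<in>V. f x = (\<Sum>e\<in>expbox D. c e * mono_fun e x)"
    "\<forall>x\<in>V. g x = (\<Sum>e\<in>expbox D. c' e * mono_fun e x)"
  then show "\<exists>c. \<forall>x\<in>V. f x + g x = (\<Sum>e\<in>expbox D. c e * mono_fun e x)"
    by (intro exI[of _ "\<lambda>e. c e + c' e"]) (simp add: distrib_right sum.distrib)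
qed

lemma box_span_scale: "box_span D f \<Longrightarrow> box_span D (\<lambda>x. k * f x)"
  unfolding box_span_def
proof (elim exE)
  fix c assume "\<forall>x\<in>V. f x = (\<Sum>e\<in>expbox D. c e * mono_fun e x)"
  then show "\<exists>c. \<forall>x\<in>V. k * f x = (\<Sum>e\<in>expbox D. c e * mono_fun e x)"
    by (intro exI[of _ "\<lambda>e. k * c e"]) (simp add: sum_distrib_left mult_ac)
qed

lemma box_span_sum: "(\<And>i. i \<in> A \<Longrightarrow> box_span D (f i)) \<Longrightarrow> box_span D (\<lambda>x. \<Sum>i\<in>A. f i x)"
  by (induction A rule: infinite_finite_induct) (auto intro: box_span_0 box_span_add)

lemma box_span_lift:
  assumes "box_span D f" "\<And>e. e \<in> expbox D \<Longrightarrow> box_span D' (\<lambda>x. t x * mono_fun e x)"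
  shows "box_span D' (\<lambda>x. t x * f x)"
proof -
  obtain c where c: "\<And>x. x \<in> V \<Longrightarrow> f x = (\<Sum>e\<in>expbox D. c e * mono_fun e x)"
    using assms(1) by (auto simp: box_span_def)
  have "box_span D' (\<lambda>x. \<Sum>e\<in>expbox D. c e * (t x * mono_fun e x))"
    by (intro box_span_sum box_span_scale assms(2))
  then show ?thesis
    by (rule box_span_cong) (simp add: c sum_distrib_left mult_ac)
qed

lemma box_span_le: "box_span D f \<Longrightarrow> D \<le> D' \<Longrightarrow> box_span D' f"
proof -
  assume f: "box_span D f" and "D \<le> D'"
  then have "e \<in> expbox D'" if "e \<in> expbox D" for e
    using that \<open>D \<le> D'\<close> by (intro expboxI) (auto dest: expboxD(1)[of e _] expboxD(2) intro: le_trans)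
  then show ?thesis
    using box_span_lift[OF f, of D' "\<lambda>_. 1"] box_span_mono_fun by simp
qed

text \<open>The cost of multiplying by \<open>f\<close>: \<open>s\<close> factors of the denominator
  and an enlargement of the box by \<open>M\<close>, uniformly in \<open>D\<close>. Both costs add
  up under products.\<close>

definition box_mult :: "nat \<Rightarrow> nat \<Rightarrow> ('a ^ 'n \<Rightarrow> 'a) \<Rightarrow> bool" where
  "box_mult s M f \<longleftrightarrow> (\<forall>D g. box_span D g \<longrightarrow> box_span (D + M) (\<lambda>x. q x ^ s * f x * g x))"

lemma box_multD: "box_mult s M f \<Longrightarrow> box_span D g \<Longrightarrow> box_span (D + M) (\<lambda>x. q x ^ s * f x * g x)"
  by (simp add: box_mult_def)

lemma box_multI:
  "(\<And>D e. e \<in> expbox D \<Longrightarrow> box_span (D + M) (\<lambda>x. q x ^ s * f x * mono_fun e x)) \<Longrightarrow> box_mult s M f"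
  unfolding box_mult_def using box_span_lift[where t = "\<lambda>x. q x ^ s * f x"] by simp

lemma box_mult_mult:
  assumes "box_mult s M f" "box_mult s' M' f'"
  shows "box_mult (s + s') (M + M') (\<lambda>x. f x * f' x)"
  unfolding box_mult_def
proof (intro allI impI)
  fix D g assume "box_span D g"
  from box_multD[OF assms(1) box_multD[OF assms(2) this]]
  show "box_span (D + (M + M')) (\<lambda>x. q x ^ (s + s') * (f x * f' x) * g x)"
    by (simp add: mult_ac add_ac power_add)
qed

lemma box_mult_le: "box_mult s M f \<Longrightarrow> M \<le> M' \<Longrightarrow> box_mult s M' f"
  unfolding box_mult_def by (meson add_le_cancel_left box_span_le)

lemma box_mult_add:
  assumes "box_mult s M f" "box_mult s M' g"
  shows "box_mult s (M + M') (\<lambda>x. f x + g x)"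
  unfolding box_mult_def distrib_left distrib_right
  using box_mult_le[OF assms(1), of "M + M'"] box_mult_le[OF assms(2), of "M + M'"]
  by (auto intro!: box_span_add dest: box_multD)

lemma box_mult_const: "box_mult 0 0 (\<lambda>_. c)"
  by (simp add: box_mult_def box_span_scale)

lemma box_mult_coord:
  assumes "j \<in> S"
  shows "box_mult 0 1 (coord j)"
proof (rule box_multI)
  fix D e assume e: "e \<in> expbox D"
  have "coord j x * mono_fun e x = mono_fun (e(j := e j + 1)) x" for x :: "'a ^ 'n"
    using mono_fun_split[of e x j] mono_fun_split[of "e(j := e j + 1)" x j] by (simp add: coord_def)
  moreover have "e(j := e j + 1) \<in> expbox (D + 1)"
    using e assms by (intro expboxI) (auto dest: expboxD intro: le_SucI)
  ultimately show "box_span (D + 1) (\<lambda>x. q x ^ 0 * coord j x * mono_fun e x)"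
    using box_span_mono_fun[of "e(j := e j + 1)" "D + 1"] box_span_cong by simp
qed

lemma box_mult_polyfun_base:
  assumes "b \<in> polyfun S"
  shows "\<exists>M. box_mult 0 M b"
  using assms
proof (induction rule: subalg.induct)
  case (const c)
  then show ?case
    using box_mult_const by blast
next
  case (gen f)
  then show ?case
    using box_mult_coord by blast
next
  case (add b b')
  then show ?case
    using box_mult_add by blast
next
  case (mult b b')
  then show ?case
    using box_mult_mult[of 0 _ b 0 _ b'] by auto
qed

lemma box_mult_uniform:
  assumes "finite A" "\<And>i. i \<in> A \<Longrightarrow> \<exists>M. box_mult s M (f i)"
  shows "\<exists>M. \<forall>i\<in>A. box_mult s M (f i)"
proof -
  obtain m where m: "\<And>i. i \<in> A \<Longrightarrow> box_mult s (m i) (f i)"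
    using assms(2) by metis
  have "box_mult s (sum m A) (f i)" if "i \<in> A" for i
    by (rule box_mult_le[OF m[OF that]]) (use assms(1) that in \<open>simp add: member_le_sum\<close>)
  then show ?thesis
    by blast
qed

text \<open>If raising the exponent of \<open>j\<close> stays below \<open>E\<close>, the monomial
  remains in the box and only the spare factor \<open>q\<close> must be absorbed. Otherwise the
  power \<open>E\<close> is reached and \<open>rel\<close> rewrites it, using up that
  factor.\<close>

lemma box_mult_other_coord:
  assumes "j \<notin> S"
  shows "\<exists>M. box_mult 1 M (coord j)"
proof -
  obtain a where a: "\<And>i. a i \<in> polyfun S"
      "\<And>x. x \<in> V \<Longrightarrow> q x * x $ j ^ E = (\<Sum>i<E. a i x * x $ j ^ i)"
    using rel[OF assms] by blast
  obtain M where M: "\<And>i. i < E \<Longrightarrow> box_mult 0 M (a i)"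
    using box_mult_uniform[of "{..<E}" 0 a] box_mult_polyfun_base[OF a(1)] by auto
  obtain M' where M': "box_mult 0 M' q"
    using box_mult_polyfun_base[OF q(1)] by blast
  have "box_mult 1 (M + M') (coord j)"
  proof (rule box_multI)
    fix D e assume e: "e \<in> expbox D"
    show "box_span (D + (M + M')) (\<lambda>x. q x ^ 1 * coord j x * mono_fun e x)"
    proof (cases "e j + 1 < E")
      case True
      have eq: "coord j x * mono_fun e x = mono_fun (e(j := e j + 1)) x" for x :: "'a ^ 'n"
        using mono_fun_split[of e x j] mono_fun_split[of "e(j := e j + 1)" x j] by (simp add: coord_def)
      have "e(j := e j + 1) \<in> expbox D"
        using e True assms by (intro expboxI) (auto dest: expboxD)
      from box_multD[OF box_mult_le[OF M' le_add2] box_span_mono_fun[OF this], of M]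
      show ?thesis
        by (rule box_span_cong) (simp add: eq mult.assoc)
    next
      case False
      then have ej: "Suc (e j) = E"
        using expboxD(2)[OF e assms] by simp
      have upd: "mono_fun (e(j := i)) x = x $ j ^ i * mono_fun (e(j := 0)) x" for i and x :: "'a ^ 'n"
        using mono_fun_split[of "e(j := i)" x j] by simp
      have "box_span (D + (M + M')) (\<lambda>x. \<Sum>i<E. q x ^ 0 * a i x * mono_fun (e(j := i)) x)"
      proof (rule box_span_sum)
        fix i assume i: "i \<in> {..<E}"
        then have "e(j := i) \<in> expbox D"
          using e assms by (intro expboxI) (auto dest: expboxD)
        then show "box_span (D + (M + M')) (\<lambda>x. q x ^ 0 * a i x * mono_fun (e(j := i)) x)"
          using i by (intro box_multD[OF box_mult_le[OF M le_add1]] box_span_mono_fun) auto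
      qed
      then show ?thesis
      proof (rule box_span_cong)
        fix x assume x: "x \<in> V"
        have "q x ^ 1 * coord j x * mono_fun e x = (q x * x $ j ^ E) * mono_fun (e(j := 0)) x"
          using mono_fun_split[of e x j] by (simp add: ej[symmetric] coord_def)
        also have "\<dots> = (\<Sum>i<E. q x ^ 0 * a i x * mono_fun (e(j := i)) x)"
          unfolding a(2)[OF x] sum_distrib_right
          by (intro sum.cong refl, subst upd) (simp add: mult.assoc)
        finally show "q x ^ 1 * coord j x * mono_fun e x = \<dots>" .
      qed
    qed
  qed
  then show ?thesis
    by blast
qed

text \<open>Surplus factors of \<open>q\<close> can be absorbed since \<open>q\<close> lies in
  \<open>polyfun S\<close>. This permits a common exponent \<open>s\<close> for several
  functions.\<close>

lemma box_mult_raise: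
  assumes "box_mult s M f"
  shows "\<exists>M'. box_mult (s + t) M' f"
proof (induction t)
  case 0
  then show ?case
    using assms by auto
next
  case (Suc t)
  then obtain M' where M': "box_mult (s + t) M' f"
    by blast
  obtain N where "box_mult 0 N q"
    using box_mult_polyfun_base[OF q(1)] by blast
  then have "box_mult 1 N (\<lambda>_. 1)"
    by (simp add: box_mult_def)
  from box_mult_mult[OF M' this] show ?case
    by auto
qed

lemma box_mult_polyfun:
  assumes "f \<in> polyfun UNIV"
  shows "\<exists>s M. box_mult s M f"
  using assms
proof (induction rule: subalg.induct)
  case (const c)
  then show ?case
    using box_mult_const by blast
next
  case (gen f)
  then show ?case
    using box_mult_coord box_mult_other_coord by blast
next
  case (add f g)
  then obtain s M s' M' where "box_mult s M f" "box_mult s' M' g"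
    by blast
  then obtain N N' where "box_mult (s + s') N f" "box_mult (s + s') N' g"
    using box_mult_raise[of s M f s'] box_mult_raise[of s' M' g s] by (auto simp: add.commute)
  then show ?case
    using box_mult_add by blast
next
  case (mult f g)
  then show ?case
    using box_mult_mult by blast
qed

lemma box_mult_polyfun_uniform:
  assumes "finite A" "A \<subseteq> polyfun UNIV"
  shows "\<exists>s M. \<forall>f\<in>A. box_mult s M f"
proof -
  obtain s where s: "\<And>f. f \<in> A \<Longrightarrow> \<exists>M. box_mult (s f) M f"
    using assms(2) box_mult_polyfun by (metis subsetD)
  have "\<exists>M. box_mult (sum s A) M f" if "f \<in> A" for f
  proof -
    have "sum s A = s f + sum s (A - {f})"
      using assms(1) that by (rule sum.remove)
    then show ?thesis
      using s[OF that] box_mult_raise by metis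
  qed
  then show ?thesis
    using box_mult_uniform[OF assms(1), of "sum s A" "\<lambda>f. f"] by blast
qed

text \<open>For \<open>k\<close> independent functions the monomials with exponents at most
  \<open>d\<close> number \<open>(d + 1) ^ k\<close>. After multiplication by one power of
  \<open>q\<close> they lie in the span of a box whose size has order \<open>d ^ card S\<close>. If
  \<open>k\<close> exceeded \<open>card S\<close>, a large \<open>d\<close> would give a linear
  dependence.\<close>

lemma length_alg_indep_le:
  assumes "alg_indep V fs" "set fs \<subseteq> polyfun UNIV"
  shows "length fs \<le> card S"
proof (rule ccontr)
  assume less: "\<not> ?thesis"
  define k where "k = length fs"
  define r where "r = card S"
  have kr: "r < k"
    using less by (simp add: k_def r_def)
  have "\<exists>s M. \<forall>f\<in>insert (\<lambda>_. 1) (set fs). box_mult s M f"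
    by (rule box_mult_polyfun_uniform) (use assms(2) in auto)
  then obtain s M where sM: "\<And>f. f \<in> set fs \<Longrightarrow> box_mult s M f" "box_mult s M (\<lambda>_. 1)"
    by auto
  \<comment> \<open>\<open>lev n\<close> bounds the cost by \<open>n\<close> times that of a single
    generator, so levels behave like degrees.\<close>
  define lev where "lev n f \<longleftrightarrow> box_mult (s * n) (M * n) f" for n f
  have lev_mult: "lev (a + b) (\<lambda>x. f x * g x)" if "lev a f" "lev b g" for a b f g
    using box_mult_mult that by (simp add: lev_def distrib_left)
  have lev1: "lev n (\<lambda>_. 1)" for n
  proof (induction n)
    case 0
    then show ?case
      by (simp add: lev_def box_mult_const)
  next
    case (Suc n)
    then show ?case
      using lev_mult[of 1 "\<lambda>_. 1" n "\<lambda>_. 1"] sM(2) by (simp add: lev_def)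
  qed
  have lev_power: "lev n (\<lambda>x. f x ^ n)" if "f \<in> set fs" for f n
  proof (induction n)
    case 0
    then show ?case
      using lev1[of 0] by simp
  next
    case (Suc n)
    then show ?case
      using lev_mult[of 1 f n "\<lambda>x. f x ^ n"] sM(1)[OF that] by (simp add: lev_def)
  qed
  have lev_mono: "lev (d * length es) (mono_list gs es)"
    if "set gs \<subseteq> set fs" "length gs = length es" "set es \<subseteq> {..d}" for d es gs
    using that(2,1,3)
  proof (induction gs es rule: list_induct2)
    case Nil
    then show ?case
      using lev1[of 0] by simp
  next
    case (Cons g gs e es)
    \<comment> \<open>Padding with the constant one brings every exponent \<open>e\<close> up to
      level \<open>d\<close>, so that all monomials need the same power of \<open>q\<close>.\<close>
    have "lev (e + (d - e)) (\<lambda>x. g x ^ e * 1)"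
      by (intro lev_mult lev_power lev1) (use Cons.prems in auto)
    then have "lev d (\<lambda>x. g x ^ e)"
      using Cons.prems by simp
    then show ?case
      using lev_mult[of d "\<lambda>x. g x ^ e" "d * length es" "mono_list gs es"] Cons by simp
  qed
  define K where "K = E ^ card (- S)"
  \<comment> \<open>Chosen so that the box has at most \<open>d * (d + 1) ^ r\<close> elements,
    which is below \<open>(d + 1) ^ (r + 1)\<close>.\<close>
  define d where "d = (M * k + 1) ^ r * K"
  define D where "D = M * (d * k)"
  have "D + 1 \<le> (M * k + 1) * (d + 1)"
    by (simp add: D_def algebra_simps)
  then have "card (expbox D) \<le> ((M * k + 1) * (d + 1)) ^ r * K"
    unfolding card_expbox r_def[symmetric] K_def[symmetric] by (intro mult_right_mono power_mono) auto
  also have "\<dots> = d * (d + 1) ^ r"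
    unfolding power_mult_distrib by (simp only: d_def mult_ac)
  also have "\<dots> < (d + 1) ^ (r + 1)"
    by simp
  also have "\<dots> \<le> (d + 1) ^ k"
    using kr by (intro power_increasing) auto
  finally have card: "card (expbox D) < card (exponents d k)"
    by (simp add: card_exponents)
  have "box_span 0 (\<lambda>_. 1)"
    by (rule box_span_cong[OF box_span_mono_fun[of "\<lambda>_. 0"]]) (use E in \<open>auto intro: expboxI\<close>)
  then have "box_span D (\<lambda>x. q x ^ (s * (d * k)) * mono_list fs es x)" if "es \<in> exponents d k" for es
    using lev_mono[of fs es d] that unfolding lev_def box_mult_def
    by (force simp: exponents_def k_def D_def)
  then obtain t where t: "\<And>es x. es \<in> exponents d k \<Longrightarrow> x \<in> V \<Longrightarrow>
      q x ^ (s * (d * k)) * mono_list fs es x = (\<Sum>e\<in>expbox D. t es e * mono_fun e x)"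
    unfolding box_span_def by metis
  obtain c where c: "\<exists>es\<in>exponents d k. c es \<noteq> 0"
      "\<And>e. e \<in> expbox D \<Longrightarrow> (\<Sum>es\<in>exponents d k. c es * t es e) = 0"
    using nontrivial_solution[OF finite_expbox finite_exponents card, of t] by blast
  obtain a where a: "a \<in> V" "q a \<noteq> 0"
    using q(2) by blast
  \<comment> \<open>The dependence holds after multiplication by a power of \<open>q\<close>; that
    power cancels because \<open>V\<close> is prime and \<open>q\<close> is nonzero somewhere on
    it.\<close>
  have "(\<Sum>es\<in>exponents d k. c es * mono_list fs es x) = 0" if "x \<in> V" for x
  proof (rule prime_set_power[OF prime polyfun_UNIV[OF q(1)] a _ _ that])
    have "mono_list fs es \<in> polyfun UNIV" for es
      using subalg_subset[OF mono_list_subalg assms(2)] .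
    then show "(\<lambda>x. \<Sum>es\<in>exponents d k. c es * mono_list fs es x) \<in> polyfun UNIV"
      by (intro subalg_sum subalg.mult subalg.const)
    fix x assume x: "x \<in> V"
    have "q x ^ (s * (d * k)) * (\<Sum>es\<in>exponents d k. c es * mono_list fs es x)
        = (\<Sum>es\<in>exponents d k. c es * (\<Sum>e\<in>expbox D. t es e * mono_fun e x))"
      unfolding sum_distrib_left[of "q x ^ _"]
      by (intro sum.cong refl) (simp add: t[OF _ x, symmetric] mult.left_commute)
    also have "\<dots> = (\<Sum>e\<in>expbox D. (\<Sum>es\<in>exponents d k. c es * t es e) * mono_fun e x)"
      unfolding sum_distrib_left sum_distrib_right mult.assoc by (rule sum.swap)
    finally show "q x ^ (s * (d * k)) * (\<Sum>es\<in>exponents d k. c es * mono_list fs es x) = 0"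
      by (simp add: c(2))
  qed
  then show False
    using alg_indep_imp_mono_list_indep[OF assms(1), where d = d and c = c] a(1) c(1) by (auto simp: k_def)
qed

end

section \<open>Chains of irreducible sets and dimension\<close>

lemma sum_power_shift:
  fixes y :: "'a::comm_semiring_1"
  shows "(\<Sum>i<e. g i * y ^ i) * y ^ D = (\<Sum>i<e + D. (if i < D then 0 else g (i - D)) * y ^ i)"
  by (induction e) (simp_all add: distrib_right power_add mult.assoc)

text \<open>Maximality gives each remaining coordinate an equation over \<open>S\<close>.
  Multiplying it by the other leading coefficients and by a power of the coordinate produces a
  common leading coefficient \<open>q\<close> and a common degree \<open>E\<close>.\<close>

lemma ex_finite_over_coords:
  fixes V :: "('a::alg_closed_field ^ 'n) set"
  assumes "prime_set V" "coords_indep V S" "\<And>j. j \<notin> S \<Longrightarrow> \<not> coords_indep V (insert j S)"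
  shows "\<exists>q E. finite_over_coords V S q E"
proof -
  have "\<exists>e. \<exists>a. (\<forall>i. a i \<in> polyfun S) \<and> (\<exists>x\<in>V. a e x \<noteq> 0) \<and>
      (\<forall>x\<in>V. (\<Sum>i\<le>e. a i x * x $ j ^ i) = 0)" if "j \<notin> S" for j
    by (rule coords_dependent_relation[OF assms(2) assms(3)[OF that]]) blast
  then have "\<exists>e. \<forall>j. j \<notin> S \<longrightarrow> (\<exists>a. (\<forall>i. a i \<in> polyfun S) \<and> (\<exists>x\<in>V. a (e j) x \<noteq> 0) \<and>
      (\<forall>x\<in>V. (\<Sum>i\<le>e j. a i x * x $ j ^ i) = 0))"
    by (intro choice) blast
  then obtain e where e: "\<forall>j. j \<notin> S \<longrightarrow> (\<exists>a. (\<forall>i. a i \<in> polyfun S) \<and> (\<exists>x\<in>V. a (e j) x \<noteq> 0) \<and>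
      (\<forall>x\<in>V. (\<Sum>i\<le>e j. a i x * x $ j ^ i) = 0))" ..
  then have "\<exists>a. \<forall>j. j \<notin> S \<longrightarrow> (\<forall>i. a j i \<in> polyfun S) \<and> (\<exists>x\<in>V. a j (e j) x \<noteq> 0) \<and>
      (\<forall>x\<in>V. (\<Sum>i\<le>e j. a j i x * x $ j ^ i) = 0)"
    by (intro choice) blast
  then obtain a where a: "\<And>j i. j \<notin> S \<Longrightarrow> a j i \<in> polyfun S"
      "\<And>j. j \<notin> S \<Longrightarrow> \<exists>x\<in>V. a j (e j) x \<noteq> 0"
      "\<And>j x. j \<notin> S \<Longrightarrow> x \<in> V \<Longrightarrow> (\<Sum>i\<le>e j. a j i x * x $ j ^ i) = 0"
    by blast
  \<comment> \<open>The sum dominates each degree, and the successor makes \<open>E\<close> positive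
    even if no coordinate lies outside \<open>S\<close>.\<close>
  define E where "E = Suc (\<Sum>j\<in>-S. e j)"
  define q where "q x = (\<Prod>j\<in>-S. a j (e j) x)" for x
  have "finite_over_coords V S q E"
  proof
    show "q \<in> polyfun S"
      unfolding q_def using a(1) by (intro subalg_prod) auto
    show "\<exists>x\<in>V. q x \<noteq> 0"
      unfolding q_def using a(1,2) by (intro prime_set_prod assms(1)) (auto intro: polyfun_UNIV)
    fix j assume j: "j \<notin> S"
    define Q where "Q x = (\<Prod>j\<in>-S-{j}. a j (e j) x)" for x
    have Q: "Q \<in> polyfun S"
      unfolding Q_def using a(1) by (intro subalg_prod) auto
    have qQ: "q x = a j (e j) x * Q x" for x
      unfolding q_def Q_def using j by (simp add: prod.remove)
    define D where "D = E - e j"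
    have "e j \<le> (\<Sum>j\<in>-S. e j)"
      using j by (intro member_le_sum) auto
    then have ED: "E = e j + D"
      by (simp add: D_def E_def)
    define b where "b i x = (if i < D then 0 else - Q x * a j (i - D) x)" for i x
    have b: "b i \<in> polyfun S" for i
    proof (cases "i < D")
      case True
      then show ?thesis
        unfolding b_def by auto
    next
      case False
      then show ?thesis
        unfolding b_def using Q a(1)[OF j] by (simp add: subalg.mult subalg_minus)
    qed
    have "q x * x $ j ^ E = (\<Sum>i<E. b i x * x $ j ^ i)" if "x \<in> V" for x
    proof -
      have "a j (e j) x * x $ j ^ e j = - (\<Sum>i<e j. a j i x * x $ j ^ i)"
        using a(3)[OF j that]
        by (simp add: lessThan_Suc_atMost[symmetric] eq_neg_iff_add_eq_0 add.commute)
      then have "q x * x $ j ^ E = (\<Sum>i<e j. (- Q x * a j i x) * x $ j ^ i) * x $ j ^ D"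
        by (simp add: qQ ED power_add sum_distrib_left sum_negf mult_ac)
      then show ?thesis
        unfolding sum_power_shift by (simp add: ED b_def)
    qed
    with b show "\<exists>b. (\<forall>i. b i \<in> polyfun S) \<and>
        (\<forall>x\<in>V. q x * x $ j ^ E = (\<Sum>i<E. b i x * x $ j ^ i))"
      by blast
  qed (use assms(1) in \<open>auto simp: E_def\<close>)
  then show ?thesis
    by blast
qed

lemma maximal_coords_indep:
  assumes "coords_indep V (S0 :: 'n::finite set)"
  obtains S where "S0 \<subseteq> S" "coords_indep V S" "\<And>j. j \<notin> S \<Longrightarrow> \<not> coords_indep V (insert j S)"
proof -
  obtain S where S: "S \<in> {S. coords_indep V S}" "S0 \<subseteq> S"
      "\<And>T. T \<in> {S. coords_indep V S} \<Longrightarrow> S \<subseteq> T \<Longrightarrow> S = T"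
    using finite_has_maximal2[of "{S. coords_indep V S}" S0] assms by auto
  then show ?thesis
    using that[of S] by (metis insertI1 mem_Collect_eq subset_insertI)
qed

text \<open>Vanishing is only assumed on \<open>V\<close> but concluded everywhere: the coefficients
  vanish on \<open>V\<close> by transcendence, hence everywhere by induction down to constants. This
  carries independence to larger sets.\<close>

lemma subalg_alg_indep_eq_0:
  assumes "alg_indep V fs" "V \<noteq> {}" "b \<in> subalg (set fs)" "\<And>x. x \<in> V \<Longrightarrow> b x = 0"
  shows "b x = 0"
  using assms(1,3,4)
proof (induction fs arbitrary: b x)
  case Nil
  have "\<exists>c. b = (\<lambda>_. c)"
    using Nil(2) by (induction rule: subalg.induct) auto
  then show ?case
    using Nil(3) assms(2) by auto
next
  case (Cons f fs)
  obtain d a where a: "\<And>i. a i \<in> subalg (set fs)" "b = (\<lambda>x. \<Sum>i\<le>d. a i x * f x ^ i)"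
    using subalg_insert_expand[of b f "set fs"] Cons.prems(2) by auto
  have "a i x = 0" if "i \<le> d" for i x
  proof (rule Cons.IH)
    show "a i x = 0" if "x \<in> V" for x
      by (rule transcendental_overD[of "subalg (set fs)" V f a d])
        (use Cons.prems a that \<open>i \<le> d\<close> in auto)
  qed (use Cons.prems a in auto)
  then show ?case
    by (simp add: a(2))
qed

lemma alg_indep_superset:
  assumes "alg_indep V fs" "V \<noteq> {}" "V \<subseteq> V'"
  shows "alg_indep V' fs"
  using assms(1)
proof (induction fs)
  case (Cons f fs)
  have "transcendental_over (subalg (set fs)) V' f"
    unfolding transcendental_over_def
  proof (intro allI impI ballI)
    fix d a i x
    assume a: "\<forall>i. a i \<in> subalg (set fs)" "\<forall>x\<in>V'. (\<Sum>i\<le>d. a i x * f x ^ i) = 0" "i \<le> d"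
    show "a i x = 0"
    proof (rule subalg_alg_indep_eq_0[of V fs])
      show "a i x = 0" if "x \<in> V" for x
        by (rule transcendental_overD[of "subalg (set fs)" V f a d])
          (use Cons.prems a that assms(3) in auto)
    qed (use Cons.prems a assms in auto)
  qed
  then show ?case
    using Cons by simp
qed simp

text \<open>In a relation for \<open>f\<close> on \<open>V'\<close>, the constant term vanishes on
  \<open>V\<close>, where \<open>f\<close> does, and hence everywhere. Then \<open>f\<close> cancels
  because \<open>V'\<close> is prime, and the shorter relation is treated in the same way.\<close>

lemma alg_indep_extend:
  assumes "alg_indep V fs" "V \<noteq> {}" "V \<subseteq> V'" "prime_set V'" "set fs \<subseteq> polyfun UNIV"
    and f: "f \<in> polyfun UNIV" "\<And>x. x \<in> V \<Longrightarrow> f x = 0" "y \<in> V'" "f y \<noteq> 0"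
  shows "alg_indep V' (f # fs)"
proof -
  have "\<forall>i\<le>d. \<forall>x\<in>V'. a i x = 0"
    if "\<forall>i. a i \<in> subalg (set fs)" "\<forall>x\<in>V'. (\<Sum>i\<le>d. a i x * f x ^ i) = 0" for d a
    using that
  proof (induction d arbitrary: a)
    case (Suc d)
    have split: "(\<Sum>i\<le>Suc d. a i x * f x ^ i) = a 0 x + f x * (\<Sum>i\<le>d. a (Suc i) x * f x ^ i)" for x
      by (subst sum.atMost_Suc_shift) (simp add: sum_distrib_left mult_ac)
    have a0: "a 0 x = 0" for x
    proof (rule subalg_alg_indep_eq_0[OF assms(1,2)])
      show "a 0 x = 0" if "x \<in> V" for x
        using bspec[OF Suc.prems(2), of x] f(2)[OF that] that assms(3) unfolding split by auto
    qed (use Suc.prems in auto)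
    have a_poly: "a i \<in> polyfun UNIV" for i
      using subalg_subset[OF _ assms(5)] Suc.prems(1) by blast
    have "(\<Sum>i\<le>d. a (Suc i) x * f x ^ i) = 0" if "x \<in> V'" for x
    proof (rule prime_setD[OF assms(4) f(1) _ _ f(3,4) that])
      show "(\<lambda>x. \<Sum>i\<le>d. a (Suc i) x * f x ^ i) \<in> polyfun UNIV"
        by (intro subalg_sum subalg.mult subalg_power a_poly f(1))
      show "f x * (\<Sum>i\<le>d. a (Suc i) x * f x ^ i) = 0" if "x \<in> V'" for x
        using bspec[OF Suc.prems(2) that] unfolding split a0 by simp
    qed
    then have "\<forall>i\<le>d. \<forall>x\<in>V'. a (Suc i) x = 0"
      using Suc.IH[of "\<lambda>i. a (Suc i)"] Suc.prems(1) by blast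
    then show ?case
      using a0 by (metis Suc_le_mono not0_implies_Suc)
  qed simp
  then show ?thesis
    using alg_indep_superset[OF assms(1-3)] by (simp add: transcendental_over_def)
qed

definition irreducible_chain :: "nat \<Rightarrow> (nat \<Rightarrow> ('a::field ^ 'n) set) \<Rightarrow> bool" where
  "irreducible_chain d C \<longleftrightarrow> (\<forall>i\<le>d. zariski_irreducible (C i)) \<and> (\<forall>i<d. C i \<subset> C (Suc i))"

lemma irreducible_chain_alg_indep:
  assumes "irreducible_chain d C"
  shows "\<exists>fs. length fs = d \<and> set fs \<subseteq> polyfun UNIV \<and> alg_indep (C d) fs"
  using assms
proof (induction d)
  case (Suc d)
  then obtain fs where fs: "length fs = d" "set fs \<subseteq> polyfun UNIV" "alg_indep (C d) fs"
    by (auto simp: irreducible_chain_def)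
  have C: "zariski_closed (C d)" "C d \<noteq> {}" "prime_set (C (Suc d))" "C d \<subset> C (Suc d)"
    using Suc.prems by (auto simp: irreducible_chain_def zariski_irreducible_iff prime_set_def)
  then obtain y where y: "y \<in> C (Suc d)" "y \<notin> C d"
    by blast
  obtain f where f: "f \<in> polyfun UNIV" "\<And>x. x \<in> C d \<Longrightarrow> f x = 0" "f y \<noteq> 0"
    using zariski_closed_separation[OF C(1) y(2)] by blast
  have "alg_indep (C (Suc d)) (f # fs)"
    by (rule alg_indep_extend[of "C d" fs "C (Suc d)" f y]) (use C fs f y in auto)
  with fs f(1) show ?case
    by (intro exI[of _ "f # fs"]) auto
qed simp

text \<open>Each strict inclusion of a chain yields one more independent function on its top, and
  \<open>length_alg_indep_le\<close> bounds their number by the size of any maximal independent set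
  of coordinates.\<close>

lemma irreducible_chain_le_card:
  fixes C :: "nat \<Rightarrow> ('a::alg_closed_field ^ 'n) set"
  assumes "irreducible_chain d C" "coords_indep (C d) S"
    "\<And>j. j \<notin> S \<Longrightarrow> \<not> coords_indep (C d) (insert j S)"
  shows "d \<le> card S"
proof -
  have "prime_set (C d)"
    using assms(1) by (simp add: irreducible_chain_def zariski_irreducible_iff)
  then obtain q E where "finite_over_coords (C d) S q E"
    using ex_finite_over_coords assms(2,3) by blast
  then show ?thesis
    using irreducible_chain_alg_indep[OF assms(1)] finite_over_coords.length_alg_indep_le by metis
qed

lemma irreducible_chain_le_CARD:
  fixes C :: "nat \<Rightarrow> ('a::alg_closed_field ^ 'n) set"
  assumes "irreducible_chain d C"
  shows "d \<le> CARD('n)"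
proof -
  have "C d \<noteq> {}"
    using assms by (auto simp: irreducible_chain_def zariski_irreducible_def)
  then obtain S where S: "coords_indep (C d) S" "\<And>j. j \<notin> S \<Longrightarrow> \<not> coords_indep (C d) (insert j S)"
    using maximal_coords_indep[OF coords_indep_empty] by metis
  have "d \<le> card S"
    using irreducible_chain_le_card[OF assms S] .
  also have "\<dots> \<le> CARD('n)"
    by (intro card_mono) auto
  finally show ?thesis .
qed

lemma zariski_dim_eq_Sup_chain:
  "zariski_dim V = Sup {ereal (real d) | d. \<exists>C. irreducible_chain d C \<and> (\<forall>i\<le>d. C i \<subseteq> V)}"
proof -
  have "(\<forall>i\<le>d. zariski_irreducible (C i) \<and> C i \<subseteq> V) \<and> (\<forall>i<d. C i \<subset> C (Suc i)) \<longleftrightarrow>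
      irreducible_chain d C \<and> (\<forall>i\<le>d. C i \<subseteq> V)" for d C
    by (auto simp: irreducible_chain_def)
  then show ?thesis
    unfolding zariski_dim_def by simp
qed

lemma le_zariski_dim_imp_chain:
  assumes "ereal (real k) \<le> zariski_dim V"
  obtains C where "irreducible_chain k C" "\<And>i. i \<le> k \<Longrightarrow> C i \<subseteq> V"
proof -
  \<comment> \<open>A supremum need not be attained a priori. A chain length above
    \<open>k - 1/2\<close> is at least \<open>k\<close>, since lengths are integers, and the chain
    may be cut off at \<open>k\<close>.\<close>
  have "ereal (real k - 1 / 2) < ereal (real k)"
    by simp
  then have "ereal (real k - 1 / 2) < zariski_dim V"
    using assms by (rule less_le_trans)
  then obtain d C where dC: "ereal (real k - 1 / 2) < ereal (real d)" "irreducible_chain d C"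
      "\<And>i. i \<le> d \<Longrightarrow> C i \<subseteq> V"
    unfolding zariski_dim_eq_Sup_chain less_Sup_iff by blast
  then have "k \<le> d"
    by simp
  then show ?thesis
    using that[of C] dC by (auto simp: irreducible_chain_def)
qed

lemma zariski_dim_le_CARD:
  "zariski_dim (V :: ('a::alg_closed_field ^ 'n) set) \<le> ereal (real CARD('n))"
  unfolding zariski_dim_eq_Sup_chain
  by (rule Sup_least) (auto dest: irreducible_chain_le_CARD)

text \<open>A chain of full length inside a proper subset could be prolonged by the whole space,
  exceeding the bound on chain lengths.\<close>

lemma zariski_dim_proper:
  fixes V :: "('a::alg_closed_field ^ 'n) set"
  assumes "V \<noteq> UNIV"
  shows "zariski_dim V \<noteq> ereal (real CARD('n))"
proof
  assume "zariski_dim V = ereal (real CARD('n))"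
  then obtain C where C: "irreducible_chain CARD('n) C" "\<And>i. i \<le> CARD('n) \<Longrightarrow> C i \<subseteq> V"
    using le_zariski_dim_imp_chain[of "CARD('n)" V] by auto
  define C' where "C' = C(Suc CARD('n) := UNIV)"
  have "C CARD('n) \<noteq> UNIV"
    using C(2)[of "CARD('n)"] assms by auto
  then have "irreducible_chain (Suc CARD('n)) C'"
    using C(1) zariski_irreducible_UNIV
    by (auto simp: irreducible_chain_def C'_def le_Suc_eq less_Suc_eq psubset_eq)
  then show False
    using irreducible_chain_le_CARD[of "Suc CARD('n)" C'] by simp
qed

lemma zariski_dim_UNIV:
  "zariski_dim (UNIV :: ('a::alg_closed_field ^ 'n) set) = ereal (real CARD('n))"
proof (rule antisym[OF zariski_dim_le_CARD])
  obtain idx :: "'n \<Rightarrow> nat" where idx: "bij_betw idx UNIV {0..<CARD('n)}"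
    using ex_bij_betw_finite_nat[of "UNIV :: 'n set"] by auto
  \<comment> \<open>The flag of coordinate subspaces: \<open>C i\<close> leaves free exactly the
    coordinates numbered below \<open>i\<close>. It is the image of the projection
    \<open>\<rho>\<close>, hence irreducible.\<close>
  define C :: "nat \<Rightarrow> ('a ^ 'n) set" where "C i = {x. \<forall>j. i \<le> idx j \<longrightarrow> x $ j = 0}" for i
  have irr: "zariski_irreducible (C i)" for i
    unfolding zariski_irreducible_iff
  proof
    show "zariski_closed (C i)"
      unfolding zariski_closed_iff C_def
      by (intro exI[of _ "coord ` {j. i \<le> idx j}"]) (auto simp: coord_def)
    define \<rho> :: "'a ^ 'n \<Rightarrow> 'a ^ 'n" where "\<rho> x = (\<chi> j. if i \<le> idx j then 0 else x $ j)" for x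
    have "\<rho> x \<in> C i" "x \<in> C i \<Longrightarrow> \<rho> x = x" for x
      by (auto simp: \<rho>_def C_def vec_eq_iff)
    then have "\<rho> ` UNIV = C i"
      by (metis (no_types, lifting) image_subset_iff rangeI subsetI subset_antisym)
    moreover have "(\<lambda>x. \<rho> x $ j) \<in> polyfun UNIV" for j
      by (cases "i \<le> idx j") (auto simp: \<rho>_def)
    ultimately show "prime_set (C i)"
      by (intro prime_set_retract)
  qed
  have "C i \<subset> C (Suc i)" if "i < CARD('n)" for i
  proof
    show "C i \<subseteq> C (Suc i)"
      by (auto simp: C_def)
    obtain j where "idx j = i"
      using idx \<open>i < CARD('n)\<close> by (metis atLeastLessThan_iff bij_betw_iff_bijections le0)
    then have "axis j 1 \<in> C (Suc i)" "axis j 1 \<notin> C i"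
      by (auto simp: C_def axis_def)
    then show "C i \<noteq> C (Suc i)"
      by blast
  qed
  then have "irreducible_chain CARD('n) C"
    using irr by (simp add: irreducible_chain_def)
  then show "ereal (real CARD('n)) \<le> zariski_dim (UNIV :: ('a ^ 'n) set)"
    unfolding zariski_dim_eq_Sup_chain by (intro Sup_upper) auto
qed

section \<open>Points over a transcendence basis\<close>

lemma sum_power_shift_atMost:
  fixes y :: "'a::comm_semiring_1"
  shows "(\<Sum>i\<le>e. g i * y ^ i) * y ^ D = (\<Sum>i\<le>e + D. (if i < D then 0 else g (i - D)) * y ^ i)"
  using sum_power_shift[of g y "Suc e" D] by (simp add: lessThan_Suc_atMost)

text \<open>On \<open>V\<close>, the constant term of a relation for \<open>h\<close> is a multiple
  of \<open>h\<close>. If it vanishes on \<open>V\<close>, one factor \<open>h\<close> is cancelled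
  and the shorter relation is used.\<close>

lemma relation_imp_divides:
  assumes V: "prime_set V" and A: "A \<subseteq> subalg X" "subalg X \<subseteq> polyfun UNIV"
    and h: "h \<in> subalg X" "\<exists>x\<in>V. h x \<noteq> 0"
    and a: "\<And>i. a i \<in> A" "\<And>x. x \<in> V \<Longrightarrow> (\<Sum>i\<le>d. a i x * h x ^ i) = 0" "\<exists>i\<le>d. \<exists>x\<in>V. a i x \<noteq> 0"
  shows "\<exists>q\<in>A. \<exists>B\<in>subalg X. (\<exists>x\<in>V. q x \<noteq> 0) \<and> (\<forall>x\<in>V. q x = h x * B x)"
  using a
proof (induction d arbitrary: a)
  case 0
  then show ?case
    by auto
next
  case (Suc d)
  have split: "(\<Sum>i\<le>Suc d. a i x * h x ^ i) = a 0 x + h x * (\<Sum>i\<le>d. a (Suc i) x * h x ^ i)" for x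
    by (subst sum.atMost_Suc_shift) (simp add: sum_distrib_left mult_ac)
  define G where "G x = (\<Sum>i\<le>d. a (Suc i) x * h x ^ i)" for x
  have G: "G \<in> subalg X"
    unfolding G_def using A(1) Suc.prems(1) h(1) by (intro subalg_sum subalg.mult subalg_power) auto
  have rel: "a 0 x + h x * G x = 0" if "x \<in> V" for x
    using Suc.prems(2)[OF that] unfolding split G_def .
  show ?case
  proof (cases "\<exists>x\<in>V. a 0 x \<noteq> 0")
    case True
    have "a 0 x = h x * - G x" if "x \<in> V" for x
      using rel[OF that] by (simp add: eq_neg_iff_add_eq_0)
    then show ?thesis
      using True Suc.prems(1) subalg_minus[OF G] by (intro bexI[of _ "a 0"] bexI[of _ "\<lambda>x. - G x"]) auto
  next
    case False
    obtain y where y: "y \<in> V" "h y \<noteq> 0"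
      using h(2) by blast
    have "G x = 0" if "x \<in> V" for x
      by (rule prime_setD[of V h G y]) (use V A h(1) G rel False y that in auto)
    moreover have "\<exists>i\<le>d. \<exists>x\<in>V. a (Suc i) x \<noteq> 0"
      using Suc.prems(3) False by (metis Suc_le_mono not0_implies_Suc)
    ultimately show ?thesis
      using Suc.IH[of "\<lambda>i. a (Suc i)"] Suc.prems(1) unfolding G_def by blast
  qed
qed

text \<open>The coordinates in \<open>S\<close> form a transcendence basis of the function field of
  \<open>V\<close>.\<close>

locale coord_basis =
  fixes V :: "('a::alg_closed_field ^ 'n) set" and S :: "'n set"
  assumes irred: "zariski_irreducible V"
    and indep: "coords_indep V S"
    and maximal: "\<And>j. j \<notin> S \<Longrightarrow> \<not> coords_indep V (insert j S)"
begin

lemma prime: "prime_set V"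
  using irred by (simp add: zariski_irreducible_iff)

lemma not_transcendental:
  assumes "h \<in> polyfun UNIV"
  shows "\<not> transcendental_over (polyfun S) V h"
proof
  assume h: "transcendental_over (polyfun S) V h"
  obtain q E where fin: "finite_over_coords V S q E"
    using ex_finite_over_coords[OF prime indep maximal] by blast
  obtain js where js: "set js = S" "distinct js"
    using finite_distinct_list[of S] by auto
  have "alg_indep V (map coord js)"
    using coords_indep_imp_alg_indep js indep by auto
  then have "alg_indep V (h # map coord js)"
    using h js(1) by simp
  then have "length (h # map coord js) \<le> card S"
    by (rule finite_over_coords.length_alg_indep_le[OF fin]) (use assms in auto)
  then show False
    using js distinct_card[of js] by simp
qed

text \<open>Nonvanishing of \<open>h\<close> can be enforced through the basis coordinates alone:
  like a norm, \<open>q\<close> is a multiple of \<open>h\<close> on \<open>V\<close> and involves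
  only \<open>S\<close>.\<close>

lemma divides_base:
  assumes "S \<subseteq> T" "h \<in> polyfun T" "\<exists>x\<in>V. h x \<noteq> 0"
  shows "\<exists>q\<in>polyfun S. \<exists>B\<in>polyfun T. (\<exists>x\<in>V. q x \<noteq> 0) \<and> (\<forall>x\<in>V. q x = h x * B x)"
proof -
  obtain d a where a: "\<And>i. a i \<in> polyfun S" "\<And>x. x \<in> V \<Longrightarrow> (\<Sum>i\<le>d. a i x * h x ^ i) = 0"
      "\<exists>i\<le>d. \<exists>x\<in>V. a i x \<noteq> 0"
    using not_transcendental[OF polyfun_UNIV[OF assms(2)]] unfolding transcendental_over_def by blast
  show ?thesis
  proof (rule relation_imp_divides[OF prime _ _ assms(2,3) a])
    show "polyfun S \<subseteq> polyfun T" "polyfun T \<subseteq> polyfun UNIV"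
      using polyfun_mono[OF _ assms(1)] polyfun_UNIV by blast+
  qed
qed

text \<open>Minimality of \<open>e\<close> makes every relation a pseudo-multiple of the relation \<open>a\<close>.\<close>

lemma vanishing_at_root:
  assumes a: "\<And>i. a i \<in> polyfun T" "\<And>y. y \<in> V \<Longrightarrow> (\<Sum>i\<le>e. a i y * y $ j ^ i) = 0"
    and min: "\<And>d c. (\<And>i. c i \<in> polyfun T) \<Longrightarrow> (\<And>y. y \<in> V \<Longrightarrow> (\<Sum>i\<le>d. c i y * y $ j ^ i) = 0) \<Longrightarrow>
       \<exists>y\<in>V. c d y \<noteq> 0 \<Longrightarrow> e \<le> d"
    and x: "\<And>f. f \<in> polyfun T \<Longrightarrow> (\<And>y. y \<in> V \<Longrightarrow> f y = 0) \<Longrightarrow> f x = 0"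
    and t: "(\<Sum>i\<le>e. a i x * t ^ i) = 0" "a e x \<noteq> 0"
    and c: "\<And>i. c i \<in> polyfun T" "\<And>y. y \<in> V \<Longrightarrow> (\<Sum>i\<le>d. c i y * y $ j ^ i) = 0"
  shows "(\<Sum>i\<le>d. c i x * t ^ i) = 0"
  using c
proof (induction d arbitrary: c)
  case 0
  then show ?case
    using x[of "c 0"] by simp
next
  case (Suc d)
  show ?case
  proof (cases "\<exists>y\<in>V. c (Suc d) y \<noteq> 0")
    case False
    then have "c (Suc d) x = 0"
      using x[OF Suc.prems(1)] by blast
    moreover have "(\<Sum>i\<le>d. c i x * t ^ i) = 0"
      by (rule Suc.IH[OF Suc.prems(1)]) (use Suc.prems(2) False in auto)
    ultimately show ?thesis
      by simp
  next
    case True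
    then have e: "e \<le> Suc d"
      using min[of c "Suc d"] Suc.prems by blast
    define D where "D = Suc d - e"
    have eD: "e + D = Suc d"
      using e by (simp add: D_def)
    define a' where "a' i y = (if i < D then 0 else a (i - D) y)" for i y
    have a': "a' i \<in> polyfun T" for i
      unfolding a'_def using a(1) by (cases "i < D") auto
    \<comment> \<open>One step of pseudo-division by the relation \<open>a\<close>, shifted by
      \<open>D\<close> so that the top coefficients cancel.\<close>
    define c' where "c' i y = a e y * c i y - c (Suc d) y * a' i y" for i y
    have c': "c' i \<in> polyfun T" for i
      unfolding c'_def by (intro subalg_diff subalg.mult a(1) a' Suc.prems(1))
    have "a' (Suc d) = a e"
    proof -
      have "Suc d - D = e" "\<not> Suc d < D"
        using eD by auto
      then show ?thesis
        by (simp add: a'_def fun_eq_iff)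
    qed
    then have c'0: "c' (Suc d) y = 0" for y
      by (simp add: c'_def)
    have comb: "(\<Sum>i\<le>d. c' i y * r ^ i) =
        a e y * (\<Sum>i\<le>Suc d. c i y * r ^ i) - c (Suc d) y * ((\<Sum>i\<le>e. a i y * r ^ i) * r ^ D)" for y r
    proof -
      have "(\<Sum>i\<le>d. c' i y * r ^ i) = (\<Sum>i\<le>Suc d. c' i y * r ^ i)"
        by (simp add: c'0)
      also have "\<dots> = a e y * (\<Sum>i\<le>Suc d. c i y * r ^ i) - c (Suc d) y * (\<Sum>i\<le>Suc d. a' i y * r ^ i)"
        unfolding c'_def left_diff_distrib sum_subtractf sum_distrib_left mult.assoc ..
      also have "(\<Sum>i\<le>Suc d. a' i y * r ^ i) = (\<Sum>i\<le>e. a i y * r ^ i) * r ^ D"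
        unfolding a'_def eD[symmetric] by (rule sum_power_shift_atMost[symmetric])
      finally show ?thesis .
    qed
    have "(\<Sum>i\<le>d. c' i x * t ^ i) = 0"
      by (rule Suc.IH[OF c']) (simp only: comb a(2) Suc.prems(2), simp)
    then show ?thesis
      unfolding comb t(1) using t(2) by simp
  qed
qed

text \<open>A generic choice of the basis coordinates is completed one coordinate at a time. At each
  stage the point satisfies all relations of \<open>V\<close> among the coordinates treated so far;
  the next value is a root of a minimal relation, which exists over an algebraically closed
  field.\<close>

lemma partial_points:
  "\<exists>q\<in>polyfun S. (\<exists>x\<in>V. q x \<noteq> 0) \<and> (\<forall>s. q s \<noteq> 0 \<longrightarrow>
    (\<exists>x. (\<forall>j\<in>S. x $ j = s $ j) \<and> (\<forall>f\<in>polyfun (S \<union> U). (\<forall>y\<in>V. f y = 0) \<longrightarrow> f x = 0)))"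
proof -
  have "finite U"
    by simp
  then show ?thesis
  proof (induction U rule: finite_induct)
    case empty
    have "(\<lambda>_. 1) \<in> polyfun S" "\<exists>x\<in>V. (1::'a) \<noteq> 0"
      using prime by (auto simp: prime_set_def)
    moreover have "\<forall>f\<in>polyfun (S \<union> {}). (\<forall>y\<in>V. f y = 0) \<longrightarrow> f s = 0" for s
      using coords_indepD[OF indep] by auto
    ultimately show ?case
      by (intro bexI[of _ "\<lambda>_. 1"] conjI) auto
  next
    case (insert j U)
    define T where "T = S \<union> U"
    have T: "S \<subseteq> T" "S \<union> insert j U = insert j T"
      by (auto simp: T_def)
    obtain q where q: "q \<in> polyfun S" "\<exists>x\<in>V. q x \<noteq> 0"
      "\<And>s. q s \<noteq> 0 \<Longrightarrow> \<exists>x. (\<forall>j\<in>S. x $ j = s $ j) \<and> (\<forall>f\<in>polyfun T. (\<forall>y\<in>V. f y = 0) \<longrightarrow> f x = 0)"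
      using insert.IH unfolding T_def by blast
    show ?case
    proof (cases "j \<in> T")
      case True
      then show ?thesis
        using q unfolding T(2) by (metis insert_absorb)
    next
      case False
      define Rel where "Rel e \<longleftrightarrow> (\<exists>a. (\<forall>i. a i \<in> polyfun T) \<and>
        (\<forall>y\<in>V. (\<Sum>i\<le>e. a i y * y $ j ^ i) = 0) \<and> (\<exists>y\<in>V. a e y \<noteq> 0))" for e
      have "j \<notin> S"
        using False T(1) by blast
      then have "\<exists>e. Rel e"
        by (rule coords_dependent_relation[OF indep maximal])
          (use polyfun_mono[OF _ T(1)] in \<open>unfold Rel_def, blast\<close>)
      define e where "e = (LEAST e. Rel e)"
      have "Rel e" and e_le: "\<And>d. Rel d \<Longrightarrow> e \<le> d"
        using LeastI_ex[OF \<open>\<exists>e. Rel e\<close>] Least_le[of Rel] by (auto simp: e_def)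
      then obtain a where a: "\<And>i. a i \<in> polyfun T"
          "\<And>y. y \<in> V \<Longrightarrow> (\<Sum>i\<le>e. a i y * y $ j ^ i) = 0" "\<exists>y\<in>V. a e y \<noteq> 0"
        unfolding Rel_def by blast
      have "e > 0"
      proof (rule ccontr)
        assume "\<not> e > 0"
        then show False
          using a(2,3) by auto
      qed
      \<comment> \<open>The leading coefficient must not vanish at the partial point
        \<open>x\<close>. The identity \<open>q' = a e * B\<close> holds at \<open>x\<close> as
        well, so a condition on the basis coordinates suffices.\<close>
      obtain q' B where q': "q' \<in> polyfun S" "B \<in> polyfun T" "\<exists>x\<in>V. q' x \<noteq> 0"
          "\<And>x. x \<in> V \<Longrightarrow> q' x = a e x * B x"
        using divides_base[OF T(1) a(1) a(3)] by blast
      have "\<exists>x\<in>V. q x * q' x \<noteq> 0"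
        using prime_setD[OF prime polyfun_UNIV[OF q(1)] polyfun_UNIV[OF q'(1)]] q(2) q'(3) by blast
      moreover have "\<exists>x. (\<forall>j\<in>S. x $ j = s $ j) \<and>
          (\<forall>f\<in>polyfun (insert j T). (\<forall>y\<in>V. f y = 0) \<longrightarrow> f x = 0)" if s: "q s * q' s \<noteq> 0" for s
      proof -
        obtain x where x': "\<forall>j\<in>S. x $ j = s $ j"
            "\<forall>f\<in>polyfun T. (\<forall>y\<in>V. f y = 0) \<longrightarrow> f x = 0"
          using q(3)[of s] s by auto
        have x: "\<And>j. j \<in> S \<Longrightarrow> x $ j = s $ j"
            "\<And>f. f \<in> polyfun T \<Longrightarrow> (\<And>y. y \<in> V \<Longrightarrow> f y = 0) \<Longrightarrow> f x = 0"
          using x' by blast+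
        have "(\<lambda>x. q' x - a e x * B x) \<in> polyfun T"
          using polyfun_mono[OF q'(1) T(1)] q'(2) a(1) by (intro subalg_diff subalg.mult)
        then have "q' x - a e x * B x = 0"
          by (rule x(2)) (use q'(4) in auto)
        moreover have "q' x = q' s"
          using q'(1) x(1) by (rule polyfun_cong)
        ultimately have ae: "a e x \<noteq> 0"
          using s by auto
        obtain t where t: "(\<Sum>i\<le>e. a i x * t ^ i) = 0"
          using alg_closed[of e "\<lambda>i. a i x"] ae \<open>e > 0\<close> by blast
        have "f (vupd x j t) = 0" if f: "f \<in> polyfun (insert j T)" "\<And>y. y \<in> V \<Longrightarrow> f y = 0" for f
        proof -
          obtain d c where c: "\<And>i. c i \<in> polyfun T" "f = (\<lambda>x. \<Sum>i\<le>d. c i x * x $ j ^ i)"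
            using polyfun_insert_expand[OF f(1)] by blast
          have "(\<Sum>i\<le>d. c i x * t ^ i) = 0"
          proof (rule vanishing_at_root[where a = a and T = T and e = e and j = j])
            show "e \<le> d" if "\<And>i. c i \<in> polyfun T" "\<And>y. y \<in> V \<Longrightarrow> (\<Sum>i\<le>d. c i y * y $ j ^ i) = 0"
              "\<exists>y\<in>V. c d y \<noteq> 0" for d c
              using that by (intro e_le) (auto simp: Rel_def)
          qed (use a x t ae f(2) c in auto)
          then show ?thesis
            by (simp add: c(2) polyfun_vupd[OF c(1) False])
        qed
        moreover have "\<forall>i\<in>S. vupd x j t $ i = s $ i"
          using x(1) \<open>j \<notin> S\<close> by auto
        ultimately show ?thesis
          by blast
      qed
      ultimately show ?thesis
        unfolding T(2) using subalg.mult[OF q(1) q'(1)]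
        by (intro bexI[of _ "\<lambda>x. q x * q' x"]) auto
    qed
  qed
qed

text \<open>Once all coordinates are treated, the point satisfies every relation of \<open>V\<close>
  and lies in \<open>V\<close> by closedness. Another factor from \<open>divides_base\<close> keeps
  \<open>h\<close> nonzero there.\<close>

lemma dominant_points:
  assumes "h \<in> polyfun UNIV" "\<exists>x\<in>V. h x \<noteq> 0"
  shows "\<exists>q\<in>polyfun S. (\<exists>x\<in>V. q x \<noteq> 0) \<and>
    (\<forall>s. q s \<noteq> 0 \<longrightarrow> (\<exists>x\<in>V. (\<forall>j\<in>S. x $ j = s $ j) \<and> h x \<noteq> 0))"
proof -
  obtain q where q: "q \<in> polyfun S" "\<exists>x\<in>V. q x \<noteq> 0"
    "\<And>s. q s \<noteq> 0 \<Longrightarrow> \<exists>x. (\<forall>j\<in>S. x $ j = s $ j) \<and> (\<forall>f\<in>polyfun UNIV. (\<forall>y\<in>V. f y = 0) \<longrightarrow> f x = 0)"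
    using partial_points[of UNIV] unfolding Un_UNIV_right by blast
  obtain q' B where q': "q' \<in> polyfun S" "\<exists>x\<in>V. q' x \<noteq> 0" "\<And>x. x \<in> V \<Longrightarrow> q' x = h x * B x"
    using divides_base[OF _ assms] by blast
  have "\<exists>x\<in>V. q x * q' x \<noteq> 0"
    using prime_setD[OF prime polyfun_UNIV[OF q(1)] polyfun_UNIV[OF q'(1)]] q(2) q'(2) by blast
  moreover have "\<exists>x\<in>V. (\<forall>j\<in>S. x $ j = s $ j) \<and> h x \<noteq> 0" if s: "q s * q' s \<noteq> 0" for s
  proof -
    obtain x where x': "\<forall>j\<in>S. x $ j = s $ j"
        "\<forall>f\<in>polyfun UNIV. (\<forall>y\<in>V. f y = 0) \<longrightarrow> f x = 0"
      using q(3)[of s] s by auto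
    have x: "\<And>j. j \<in> S \<Longrightarrow> x $ j = s $ j"
        "\<And>f. f \<in> polyfun UNIV \<Longrightarrow> (\<And>y. y \<in> V \<Longrightarrow> f y = 0) \<Longrightarrow> f x = 0"
      using x' by blast+
    have "x \<in> V"
    proof (rule ccontr)
      assume "x \<notin> V"
      then show False
        using zariski_closed_separation[of V x] irred x(2) unfolding zariski_irreducible_def by metis
    qed
    moreover have "q' x = q' s"
      using q'(1) x(1) by (rule polyfun_cong)
    ultimately show ?thesis
      using q'(3)[of x] x(1) s by (intro bexI[of _ x]) auto
  qed
  ultimately show ?thesis
    using subalg.mult[OF q(1) q'(1)] by (intro bexI[of _ "\<lambda>x. q x * q' x"]) auto
qed

end

text \<open>Let \<open>Z0\<close> be a maximal independent part of \<open>Z\<close>. As it has fewer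
  than \<open>k\<close> elements, some coordinate \<open>y\<close> is independent of it. Moving
  \<open>y\<close> with \<open>Z0\<close> fixed gives infinitely many points, while the other
  coordinates in \<open>Z\<close> are algebraic over \<open>Z0\<close> and take finitely many
  values.\<close>

lemma infinite_fiber:
  fixes C :: "nat \<Rightarrow> ('a::alg_closed_field ^ 'n) set"
  assumes chain: "irreducible_chain k C" and Z: "card Z < k"
    and h: "h \<in> polyfun UNIV" "\<exists>x\<in>C k. h x \<noteq> 0"
  obtains P where "P \<subseteq> C k" "infinite P" "\<And>x. x \<in> P \<Longrightarrow> h x \<noteq> 0"
    "\<And>x y z. x \<in> P \<Longrightarrow> y \<in> P \<Longrightarrow> z \<in> Z \<Longrightarrow> x $ z = y $ z"
proof -
  define V where "V = C k"
  have irred: "zariski_irreducible V" and prime: "prime_set V" and "V \<noteq> {}"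
    using chain by (auto simp: irreducible_chain_def zariski_irreducible_iff V_def prime_set_def)
  have "{} \<in> {T. T \<subseteq> Z \<and> coords_indep V T}"
    using coords_indep_empty[OF \<open>V \<noteq> {}\<close>] by simp
  then obtain Z0 where Z0: "Z0 \<in> {T. T \<subseteq> Z \<and> coords_indep V T}"
      "\<And>T. T \<in> {T. T \<subseteq> Z \<and> coords_indep V T} \<Longrightarrow> Z0 \<subseteq> T \<Longrightarrow> Z0 = T"
    using finite_has_maximal2[of "{T. T \<subseteq> Z \<and> coords_indep V T}" "{}"] by auto
  have "card Z0 \<le> card Z"
    using Z0(1) by (intro card_mono) auto
  then have "\<not> k \<le> card Z0"
    using Z by simp
  then obtain y where y: "y \<notin> Z0" "coords_indep V (insert y Z0)"
    using irreducible_chain_le_card[OF chain, of Z0] Z0(1) unfolding V_def by blast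
  obtain S where S: "insert y Z0 \<subseteq> S" "coords_indep V S" "\<And>j. j \<notin> S \<Longrightarrow> \<not> coords_indep V (insert j S)"
    using maximal_coords_indep[OF y(2)] by blast
  interpret coord_basis V S
    using irred S(2,3) by unfold_locales
  obtain q where q: "q \<in> polyfun S" "\<exists>x\<in>V. q x \<noteq> 0"
      "\<And>s. q s \<noteq> 0 \<Longrightarrow> \<exists>x\<in>V. (\<forall>j\<in>S. x $ j = s $ j) \<and> h x \<noteq> 0"
    using dominant_points[OF h[folded V_def]] by blast
  have "\<exists>p. (\<forall>i. snd p i \<in> polyfun Z0) \<and> (\<exists>x\<in>V. snd p (fst p) x \<noteq> 0) \<and>
      (\<forall>x\<in>V. (\<Sum>i\<le>fst p. snd p i x * x $ z ^ i) = 0)" if z: "z \<in> Z - Z0" for z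
  proof -
    have "\<not> coords_indep V (insert z Z0)"
      using Z0 z by blast
    with Z0(1) show ?thesis
    proof (elim coords_dependent_relation[of V Z0 z, rotated])
      fix e a assume "\<And>i. a i \<in> polyfun Z0" "\<exists>x\<in>V. a e x \<noteq> 0"
        "\<And>x. x \<in> V \<Longrightarrow> (\<Sum>i\<le>e. a i x * x $ z ^ i) = 0"
      then show ?thesis
        by (intro exI[of _ "(e, a)"]) auto
    qed simp
  qed
  then have "\<exists>p. \<forall>z\<in>Z - Z0. (\<forall>i. snd (p z) i \<in> polyfun Z0) \<and>
      (\<exists>x\<in>V. snd (p z) (fst (p z)) x \<noteq> 0) \<and>
      (\<forall>x\<in>V. (\<Sum>i\<le>fst (p z). snd (p z) i x * x $ z ^ i) = 0)"
    by (intro bchoice ballI)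
  then obtain p where p: "\<forall>z\<in>Z - Z0. (\<forall>i. snd (p z) i \<in> polyfun Z0) \<and>
      (\<exists>x\<in>V. snd (p z) (fst (p z)) x \<noteq> 0) \<and>
      (\<forall>x\<in>V. (\<Sum>i\<le>fst (p z). snd (p z) i x * x $ z ^ i) = 0)"
    ..
  define e where "e z = fst (p z)" for z
  define a where "a z = snd (p z)" for z
  have a: "\<And>z i. z \<in> Z - Z0 \<Longrightarrow> a z i \<in> polyfun Z0"
      "\<And>z. z \<in> Z - Z0 \<Longrightarrow> \<exists>x\<in>V. a z (e z) x \<noteq> 0"
      "\<And>z x. z \<in> Z - Z0 \<Longrightarrow> x \<in> V \<Longrightarrow> (\<Sum>i\<le>e z. a z i x * x $ z ^ i) = 0"
    using p by (auto simp: a_def e_def)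
  \<comment> \<open>The product of the leading coefficients; where it is nonzero, the equations for
    the coordinates in \<open>Z - Z0\<close> have finitely many roots.\<close>
  define A where "A x = (\<Prod>z\<in>Z - Z0. a z (e z) x)" for x
  have "\<exists>x\<in>V. A x \<noteq> 0"
    unfolding A_def using a(1,2) by (intro prime_set_prod prime) (auto intro: polyfun_UNIV)
  moreover have "A \<in> polyfun UNIV"
    unfolding A_def using a(1) by (intro subalg_prod) (auto intro: polyfun_UNIV)
  ultimately obtain s where "q s * A s \<noteq> 0"
    using prime_setD[OF prime polyfun_UNIV[OF q(1)]] q(2) by blast
  then have s: "q s \<noteq> 0" "\<And>z. z \<in> Z - Z0 \<Longrightarrow> a z (e z) s \<noteq> 0"
    by (auto simp: A_def)
  \<comment> \<open>Along the line through \<open>s\<close> in direction \<open>y\<close>,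
    \<open>q\<close> is a nonzero polynomial in one variable.\<close>
  have "infinite {t. q (vupd s y t) \<noteq> 0}"
  proof -
    have "q \<in> polyfun (insert y (S - {y}))"
      using q(1) S(1) by (simp add: insert_absorb)
    then obtain d c where c: "\<And>i. c i \<in> polyfun (S - {y})" "q = (\<lambda>x. \<Sum>i\<le>d. c i x * x $ y ^ i)"
      using polyfun_insert_expand by blast
    have "q (vupd s y t) = (\<Sum>i\<le>d. c i s * t ^ i)" for t
      by (simp add: c(2) polyfun_vupd[OF c(1)])
    moreover obtain i where "i \<le> d" "c i s \<noteq> 0"
      using s(1) unfolding c(2) by (metis (no_types, lifting) atMost_iff mult_not_zero sum.neutral)
    ultimately have "finite {t. q (vupd s y t) = 0}"
      using finite_roots_sum[of i d "\<lambda>i. c i s"] by simp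
    then show ?thesis
      using infinite_UNIV_alg_closed Diff_infinite_finite[of "{t. q (vupd s y t) = 0}" UNIV]
      by (simp add: set_diff_eq)
  qed
  moreover have "\<exists>X. \<forall>t\<in>{t. q (vupd s y t) \<noteq> 0}.
      X t \<in> V \<and> (\<forall>j\<in>S. X t $ j = vupd s y t $ j) \<and> h (X t) \<noteq> 0"
    by (intro bchoice ballI) (use q(3) in blast)
  ultimately obtain \<Theta> X where \<Theta>: "infinite \<Theta>"
    and X: "\<And>t. t \<in> \<Theta> \<Longrightarrow> X t \<in> V" "\<And>t j. t \<in> \<Theta> \<Longrightarrow> j \<in> S \<Longrightarrow> X t $ j = vupd s y t $ j"
      "\<And>t. t \<in> \<Theta> \<Longrightarrow> h (X t) \<noteq> 0"
    by blast
  have Xy: "X t $ y = t" if "t \<in> \<Theta>" for t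
    using X(2)[OF that, of y] S(1) by auto
  have XZ0: "X t $ z = s $ z" if "t \<in> \<Theta>" "z \<in> Z0" for t z
    using X(2)[OF that(1), of z] S(1) y(1) that(2) by auto
  \<comment> \<open>\<open>R z\<close> contains all values that coordinate \<open>z\<close> can take
    at the points \<open>X t\<close>. It depends on \<open>s\<close> only, because \<open>y\<close>
    is not in \<open>Z0\<close>.\<close>
  define R where "R z = (if z \<in> Z0 then {s $ z} else {r. (\<Sum>i\<le>e z. a z i s * r ^ i) = 0})" for z
  have "finite (R z)" if "z \<in> Z" for z
    using finite_roots_sum[of "e z" "e z" "\<lambda>i. a z i s"] s(2) that by (auto simp: R_def)
  then have "finite (PiE Z R)"
    by (intro finite_PiE) auto
  moreover have "(\<lambda>t. restrict (\<lambda>z. X t $ z) Z) ` \<Theta> \<subseteq> PiE Z R"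
  proof (intro image_subsetI PiE_I)
    fix t z assume tz: "t \<in> \<Theta>" "z \<in> Z"
    show "restrict (\<lambda>z. X t $ z) Z z \<in> R z"
    proof (cases "z \<in> Z0")
      case True
      then show ?thesis
        using XZ0 tz by (simp add: R_def)
    next
      case False
      then have "a z i (X t) = a z i s" for i
        using polyfun_cong[of "a z i" Z0 "X t" s] a(1)[of z i] XZ0[OF tz(1)] tz(2) by blast
      then show ?thesis
        using a(3)[of z "X t"] X(1) False tz by (simp add: R_def)
    qed
  qed auto
  ultimately have "finite ((\<lambda>t. restrict (\<lambda>z. X t $ z) Z) ` \<Theta>)"
    by (rule rev_finite_subset)
  \<comment> \<open>By the pigeonhole principle infinitely many of the points agree on
    \<open>Z\<close>. They stay distinct since their \<open>y\<close>-coordinate is the parameter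
    \<open>t\<close>.\<close>
  then obtain t0 where t0: "infinite {t \<in> \<Theta>. restrict (\<lambda>z. X t $ z) Z = restrict (\<lambda>z. X t0 $ z) Z}"
    using pigeonhole_infinite[OF \<Theta>] by blast
  define \<Theta>' where "\<Theta>' = {t \<in> \<Theta>. restrict (\<lambda>z. X t $ z) Z = restrict (\<lambda>z. X t0 $ z) Z}"
  have "inj_on X \<Theta>'"
    by (rule inj_onI) (metis (no_types, lifting) Xy \<Theta>'_def mem_Collect_eq)
  then have inf: "infinite (X ` \<Theta>')"
    using t0 finite_imageD[of X \<Theta>'] by (auto simp: \<Theta>'_def)
  have agree: "x $ z = X t0 $ z" if x: "x \<in> X ` \<Theta>'" and z: "z \<in> Z" for x z
  proof -
    obtain t where t: "t \<in> \<Theta>'" "x = X t"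
      using x by blast
    then have "restrict (\<lambda>z. X t $ z) Z z = restrict (\<lambda>z. X t0 $ z) Z z"
      by (simp add: \<Theta>'_def)
    then show ?thesis
      using t z by simp
  qed
  show ?thesis
  proof (rule that[of "X ` \<Theta>'"])
    show "X ` \<Theta>' \<subseteq> C k"
      using X(1) by (auto simp: \<Theta>'_def V_def)
    show "h x \<noteq> 0" if "x \<in> X ` \<Theta>'" for x
      using that X(3) by (auto simp: \<Theta>'_def)
    show "x $ z = y $ z" if "x \<in> X ` \<Theta>'" "y \<in> X ` \<Theta>'" "z \<in> Z" for x y z
      using agree[OF that(1,3)] agree[OF that(2,3)] by simp
  qed (fact inf)
qed

section \<open>Kernels of finite rank\<close>

definition finite_rank :: "('b \<Rightarrow> 'b \<Rightarrow> 'a::field) \<Rightarrow> bool" where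
  "finite_rank u \<longleftrightarrow> (\<exists>L. \<forall>x y. u x y = (\<Sum>(a, b)\<leftarrow>L. a x * b y))"

lemma finite_rank_tensor: "finite_rank (\<lambda>x y. a x * b y)"
  unfolding finite_rank_def by (intro exI[of _ "[(a, b)]"]) simp

lemma finite_rank_left: "finite_rank (\<lambda>x y. a x)"
  using finite_rank_tensor[of a "\<lambda>_. 1"] by simp

lemma finite_rank_right: "finite_rank (\<lambda>x y. b y)"
  using finite_rank_tensor[of "\<lambda>_. 1" b] by simp

lemma finite_rank_add:
  assumes "finite_rank u" "finite_rank v"
  shows "finite_rank (\<lambda>x y. u x y + v x y)"
proof -
  obtain L L' where "\<And>x y. u x y = (\<Sum>(a, b)\<leftarrow>L. a x * b y)" "\<And>x y. v x y = (\<Sum>(a, b)\<leftarrow>L'. a x * b y)"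
    using assms unfolding finite_rank_def by blast
  then show ?thesis
    unfolding finite_rank_def by (intro exI[of _ "L @ L'"]) simp
qed

lemma finite_rank_sum:
  "(\<And>i. i \<in> A \<Longrightarrow> finite_rank (u i)) \<Longrightarrow> finite_rank (\<lambda>x y. \<Sum>i\<in>A. u i x y)"
  by (induction A rule: infinite_finite_induct)
    (auto intro: finite_rank_add finite_rank_left[of "\<lambda>_. 0"])

lemma finite_rank_mult:
  assumes "finite_rank u" "finite_rank v"
  shows "finite_rank (\<lambda>x y. u x y * v x y)"
proof -
  obtain L L' where L: "\<And>x y. u x y = (\<Sum>(a, b)\<leftarrow>L. a x * b y)" "\<And>x y. v x y = (\<Sum>(a, b)\<leftarrow>L'. a x * b y)"
    using assms unfolding finite_rank_def by blast
  have "finite_rank (\<lambda>x y. a x * b y * v x y)" for a b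
  proof -
    have "a x * b y * v x y = (\<Sum>(a', b')\<leftarrow>map (\<lambda>(a', b'). (\<lambda>x. a x * a' x, \<lambda>y. b y * b' y)) L'. a' x * b' y)" for x y
      unfolding L(2) by (induction L') (auto simp: algebra_simps)
    then show ?thesis
      unfolding finite_rank_def by blast
  qed
  then have "finite_rank (\<lambda>x y. (\<Sum>(a, b)\<leftarrow>L. a x * b y) * v x y)"
    by (induction L) (auto simp: distrib_right intro: finite_rank_add finite_rank_left[of "\<lambda>_. 0"])
  then show ?thesis
    by (simp add: L(1))
qed

lemma finite_rank_prod:
  "(\<And>i. i \<in> A \<Longrightarrow> finite_rank (u i)) \<Longrightarrow> finite_rank (\<lambda>x y. \<Prod>i\<in>A. u i x y)"
  by (induction A rule: infinite_finite_induct)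
    (auto intro: finite_rank_mult finite_rank_left[of "\<lambda>_. 1"])

lemma finite_rank_det:
  assumes "\<And>i j. finite_rank (\<lambda>x y. M x y $ i $ j)"
  shows "finite_rank (\<lambda>x y. det (M x y :: 'a::field ^ 'n ^ 'n))"
  unfolding det_def
  by (intro finite_rank_sum finite_rank_mult finite_rank_prod assms finite_rank_left)

lemma finite_rank_comp:
  assumes "finite_rank u"
  shows "finite_rank (\<lambda>x y. u (\<phi> x) (\<phi> y))"
proof -
  obtain L where L: "\<And>x y. u x y = (\<Sum>(a, b)\<leftarrow>L. a x * b y)"
    using assms unfolding finite_rank_def by blast
  have "u (\<phi> x) (\<phi> y) = (\<Sum>(a, b)\<leftarrow>map (\<lambda>(a, b). (\<lambda>x. a (\<phi> x), \<lambda>y. b (\<phi> y))) L. a x * b y)" for x y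
    unfolding L by (induction L) auto
  then show ?thesis
    unfolding finite_rank_def by blast
qed

text \<open>Restricted to \<open>P\<close>, the kernel is a diagonal matrix with nonzero diagonal,
  so its rank is the number of points. More points than terms would give a nontrivial combination
  killing all right factors, which contradicts the diagonal entry at a point with nonzero
  weight.\<close>

lemma finite_rank_diagonal:
  assumes "finite_rank u" "\<And>x. x \<in> P \<Longrightarrow> u x x \<noteq> 0"
    "\<And>x y. x \<in> P \<Longrightarrow> y \<in> P \<Longrightarrow> x \<noteq> y \<Longrightarrow> u x y = 0"
  shows "finite P"
proof (rule ccontr)
  assume "infinite P"
  obtain L where L: "\<And>x y. u x y = (\<Sum>(a, b)\<leftarrow>L. a x * b y)"
    using assms(1) unfolding finite_rank_def by blast
  obtain P' where P': "P' \<subseteq> P" "finite P'" "card P' = Suc (length L)"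
    using infinite_arbitrarily_large[OF \<open>infinite P\<close>] by blast
  have u: "u x y = (\<Sum>i<length L. fst (L ! i) x * snd (L ! i) y)" for x y
    unfolding L by (simp add: sum_list_sum_nth atLeast0LessThan case_prod_beta)
  obtain c where c: "\<exists>y\<in>P'. c y \<noteq> 0" "\<And>i. i < length L \<Longrightarrow> (\<Sum>y\<in>P'. c y * snd (L ! i) y) = 0"
    using nontrivial_solution[of "{..<length L}" P' "\<lambda>y i. snd (L ! i) y"] P' by auto
  then obtain x where x: "x \<in> P'" "c x \<noteq> 0"
    by blast
  have "u x y = 0" if "y \<in> P' - {x}" for y
    using assms(3)[of x y] P'(1) x(1) that by auto
  then have "c x * u x x = (\<Sum>y\<in>P'. c y * u x y)"
    using P'(2) x(1) by (simp add: sum.remove[of _ x])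
  also have "\<dots> = (\<Sum>y\<in>P'. \<Sum>i<length L. fst (L ! i) x * (c y * snd (L ! i) y))"
    by (simp add: u sum_distrib_left mult_ac)
  also have "\<dots> = (\<Sum>i<length L. fst (L ! i) x * (\<Sum>y\<in>P'. c y * snd (L ! i) y))"
    unfolding sum_distrib_left by (rule sum.swap)
  also have "\<dots> = 0"
    by (simp add: c(2))
  finally show False
    using x assms(2) P' by auto
qed

section \<open>Separable relations of minimal degree\<close>

text \<open>Induction on the variables that occur: slices with a fixed exponent of \<open>j\<close>
  are the coefficients of powers of that coordinate and vanish by
  \<open>polyfun_coeffs_eq_0\<close>.\<close>

lemma mono_fun_linear_independent:
  fixes c :: "('n::finite \<Rightarrow> nat) \<Rightarrow> 'a::alg_closed_field"
  assumes "finite A" "\<And>x. (\<Sum>e\<in>A. c e * mono_fun e x) = 0" "e \<in> A"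
  shows "c e = 0"
proof -
  have "c e = 0" if "finite T" "finite A" "\<And>e j. e \<in> A \<Longrightarrow> j \<notin> T \<Longrightarrow> e j = 0"
    "\<And>x. (\<Sum>e\<in>A. c e * mono_fun e x) = 0" "e \<in> A" for T A e and c :: "('n \<Rightarrow> nat) \<Rightarrow> 'a"
    using that
  proof (induction T arbitrary: A c e rule: finite_induct)
    case empty
    then have "e' = (\<lambda>_. 0)" if "e' \<in> A" for e'
      using that by (simp add: fun_eq_iff)
    then have "A = {\<lambda>_. 0}"
      using empty.prems(4) by blast
    then show ?case
      using empty.prems by simp
  next
    case (insert j T)
    define A' where "A' i = {e\<in>A. e j = i}" for i
    define a where "a i x = (\<Sum>e\<in>A' i. c e * mono_fun (e(j := 0)) x)" for i x
    have fin: "finite (A' i)" for i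
      using insert.prems(1) by (simp add: A'_def)
    have a: "a i \<in> polyfun T" for i
      unfolding a_def using insert.prems(2)
      by (intro subalg_sum subalg.mult subalg.const mono_fun_polyfun) (auto simp: A'_def)
    define d where "d = Max ((\<lambda>e. e j) ` A)"
    have d: "e j \<le> d" if "e \<in> A" for e
      unfolding d_def using insert.prems(1) that by (intro Max_ge) auto
    have "(\<Sum>i\<le>d. a i x * x $ j ^ i) = 0" for x
    proof -
      have "(\<Sum>i\<le>d. a i x * x $ j ^ i) = (\<Sum>i\<le>d. \<Sum>e\<in>A' i. c e * mono_fun e x)"
      proof -
        have "c e * mono_fun (e(j := 0)) x * x $ j ^ i = c e * mono_fun e x" if "e \<in> A' i" for e i
          using that mono_fun_split[of e x j] by (simp add: A'_def mult_ac)
        then show ?thesis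
          unfolding a_def sum_distrib_right by (intro sum.cong refl) simp
      qed
      also have "\<dots> = (\<Sum>e\<in>A. c e * mono_fun e x)"
        unfolding A'_def using insert.prems(1) d by (intro sum.group) auto
      finally show ?thesis
        using insert.prems(3) by simp
    qed
    then have a0: "a i x = 0" if "i \<le> d" for i x
      using polyfun_coeffs_eq_0[of a T j d i x] a insert.hyps(2) that by blast
    define i where "i = e j"
    have inj: "inj_on (\<lambda>e. e(j := 0)) (A' i)"
      by (rule inj_onI) (metis (mono_tags, lifting) A'_def fun_upd_triv fun_upd_upd mem_Collect_eq)
    \<comment> \<open>Within a slice the exponent of \<open>j\<close> is erased for the induction
      hypothesis and restored when the coefficient is looked up.\<close>
    have "(c \<circ> (\<lambda>e. e(j := i))) (e(j := 0)) = 0"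
    proof (rule insert.IH)
      show "finite ((\<lambda>e. e(j := 0)) ` A' i)"
        using fin by simp
      show "e' k = 0" if "e' \<in> (\<lambda>e. e(j := 0)) ` A' i" "k \<notin> T" for e' k
        using that insert.prems(2) by (auto simp: A'_def)
      show "e(j := 0) \<in> (\<lambda>e. e(j := 0)) ` A' i"
        using insert.prems(4) by (auto simp: A'_def i_def)
      show "(\<Sum>e\<in>(\<lambda>e. e(j := 0)) ` A' i. (c \<circ> (\<lambda>e. e(j := i))) e * mono_fun e x) = 0" for x
      proof -
        have "(\<Sum>e\<in>(\<lambda>e. e(j := 0)) ` A' i. (c \<circ> (\<lambda>e. e(j := i))) e * mono_fun e x) = a i x"
          unfolding sum.reindex[OF inj] a_def by (intro sum.cong) (auto simp: A'_def)
        then show ?thesis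
          using a0[of i x] d[OF insert.prems(4)] by (simp add: i_def)
      qed
    qed
    then show ?case
      by (simp add: i_def)
  qed
  from this[of UNIV A c e] show ?thesis
    using assms by simp
qed

definition degs :: "nat \<Rightarrow> ('n::finite \<Rightarrow> nat) set" where
  "degs d = {e. sum e UNIV \<le> d}"

lemma finite_degs: "finite (degs d :: ('n::finite \<Rightarrow> nat) set)"
proof (rule finite_subset)
  show "degs d \<subseteq> PiE (UNIV :: 'n set) (\<lambda>_. {..d})"
    unfolding degs_def
    by (auto simp: PiE_iff intro: order_trans[OF member_le_sum[of _ UNIV]])
qed (simp add: finite_PiE)

text \<open>Makes the total degree bound and the coefficients explicit, as required for minimal
  degree, derivatives and \<open>p\<close>-th roots.\<close>

definition degpoly :: "nat \<Rightarrow> (('n::finite \<Rightarrow> nat) \<Rightarrow> 'a::comm_ring_1) \<Rightarrow> 'a ^ 'n \<Rightarrow> 'a" where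
  "degpoly d c y = (\<Sum>e\<in>degs d. c e * mono_fun e y)"

lemma polyfun_imp_degpoly:
  assumes "f \<in> polyfun UNIV"
  shows "\<exists>d c. f = degpoly d c"
proof -
  obtain p where p: "f = mvpoly_eval p"
    using polyfun_imp_mvpoly_eval[OF assms] by blast
  define K where "K = Poly_Mapping.lookup ` Poly_Mapping.keys p"
  define c where "c e = (if e \<in> K then Poly_Mapping.lookup p (Abs_poly_mapping e) else 0)" for e
  define d where "d = (\<Sum>e\<in>K. sum e UNIV)"
  have "finite K"
    by (simp add: K_def)
  then have sub: "K \<subseteq> degs d"
    unfolding degs_def d_def by (auto intro: member_le_sum)
  have inj: "inj_on Poly_Mapping.lookup (Poly_Mapping.keys p)"
    by (simp add: inj_on_def poly_mapping.lookup_inject)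
  have "f x = degpoly d c x" for x
  proof -
    have "degpoly d c x = (\<Sum>e\<in>K. c e * mono_fun e x)"
      unfolding degpoly_def using sub finite_degs by (intro sum.mono_neutral_right) (auto simp: c_def)
    also have "\<dots> = (\<Sum>k\<in>Poly_Mapping.keys p. Poly_Mapping.lookup p k * mono_fun (Poly_Mapping.lookup k) x)"
      unfolding K_def sum.reindex[OF inj]
      by (intro sum.cong refl) (auto simp: c_def K_def poly_mapping.lookup_inverse)
    finally show ?thesis
      by (simp add: p mvpoly_eval_superset[OF finite_keys order_refl])
  qed
  then show ?thesis
    by blast
qed

section \<open>Difference quotients and formal derivatives\<close>

text \<open>An algebraic form of Hadamard's lemma: \<open>B l\<close> are difference quotients, and
  their diagonal \<open>\<delta> l\<close> serves as the partial derivative. Finite rank is recorded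
  because the Jacobian determinant is later treated as a kernel.\<close>

definition hadamard ::
    "('a::field ^ 'n \<Rightarrow> 'a) \<Rightarrow> ('n \<Rightarrow> 'a ^ 'n \<Rightarrow> 'a ^ 'n \<Rightarrow> 'a) \<Rightarrow> ('n \<Rightarrow> 'a ^ 'n \<Rightarrow> 'a) \<Rightarrow> bool" where
  "hadamard f B \<delta> \<longleftrightarrow> (\<forall>x y. f x - f y = (\<Sum>l\<in>UNIV. B l x y * (x $ l - y $ l))) \<and>
     (\<forall>l. finite_rank (B l)) \<and> (\<forall>l x. B l x x = \<delta> l x)"

lemma hadamard_const: "hadamard (\<lambda>_. c) (\<lambda>_ _ _. 0) (\<lambda>_ _. 0)"
  using finite_rank_left[of "\<lambda>_. 0"] by (simp add: hadamard_def)

lemma hadamard_add: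
  assumes "hadamard f B \<delta>" "hadamard g B' \<delta>'"
  shows "hadamard (\<lambda>x. f x + g x) (\<lambda>l x y. B l x y + B' l x y) (\<lambda>l x. \<delta> l x + \<delta>' l x)"
proof -
  have "f x + g x - (f y + g y) = (f x - f y) + (g x - g y)" for x y
    by simp
  then show ?thesis
    using assms unfolding hadamard_def
    by (auto simp: distrib_right sum.distrib intro: finite_rank_add)
qed

lemma hadamard_mult:
  assumes "hadamard f B \<delta>" "hadamard g B' \<delta>'"
  shows "hadamard (\<lambda>x. f x * g x) (\<lambda>l x y. f x * B' l x y + B l x y * g y)
    (\<lambda>l x. f x * \<delta>' l x + \<delta> l x * g x)"
proof -
  have "f x * g x - f y * g y = f x * (g x - g y) + (f x - f y) * g y" for x y
    by (simp add: algebra_simps)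
  moreover have "f x * (g x - g y) + (f x - f y) * g y =
      (\<Sum>l\<in>UNIV. (f x * B' l x y + B l x y * g y) * (x $ l - y $ l))" for x y
  proof -
    have "f x * (g x - g y) + (f x - f y) * g y =
      f x * (\<Sum>l\<in>UNIV. B' l x y * (x $ l - y $ l)) + (\<Sum>l\<in>UNIV. B l x y * (x $ l - y $ l)) * g y"
      using assms by (simp add: hadamard_def)
    also have "\<dots> = (\<Sum>l\<in>UNIV. f x * (B' l x y * (x $ l - y $ l)) + B l x y * (x $ l - y $ l) * g y)"
      by (simp add: sum_distrib_left sum_distrib_right sum.distrib)
    finally show ?thesis
      unfolding distrib_right by (simp add: mult_ac)
  qed
  moreover have "finite_rank (\<lambda>x y. f x * B' l x y + B l x y * g y)" for l
    using assms unfolding hadamard_def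
    by (intro finite_rank_add finite_rank_mult finite_rank_left finite_rank_right) auto
  ultimately show ?thesis
    using assms by (simp add: hadamard_def)
qed

lemma hadamard_sum:
  assumes "finite A" "\<And>i. i \<in> A \<Longrightarrow> hadamard (f i) (B i) (\<delta> i)"
  shows "hadamard (\<lambda>x. \<Sum>i\<in>A. f i x) (\<lambda>l x y. \<Sum>i\<in>A. B i l x y) (\<lambda>l x. \<Sum>i\<in>A. \<delta> i l x)"
  using assms
proof (induction A rule: finite_induct)
  case empty
  then show ?case
    using hadamard_const[of 0] by simp
next
  case (insert i A)
  have "hadamard (f i) (B i) (\<delta> i)"
    using insert.prems by simp
  moreover have "hadamard (\<lambda>x. \<Sum>i\<in>A. f i x) (\<lambda>l x y. \<Sum>i\<in>A. B i l x y) (\<lambda>l x. \<Sum>i\<in>A. \<delta> i l x)"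
    using insert by simp
  ultimately show ?case
    using insert.hyps hadamard_add by force
qed

lemma hadamard_coord_power:
  fixes j :: "'n::finite"
  shows "\<exists>B. hadamard (\<lambda>x :: 'a::field ^ 'n. (x $ j) ^ k) B (\<lambda>l x. if l = j then of_nat k * (x $ j) ^ (k - 1) else 0)"
proof (induction k)
  case 0
  then show ?case
    using hadamard_const[of 1] by (intro exI) (simp add: if_distrib cong: if_cong)
next
  case (Suc k)
  then obtain B where B: "hadamard (\<lambda>x :: 'a ^ 'n. (x $ j) ^ k) B (\<lambda>l x. if l = j then of_nat k * (x $ j) ^ (k - 1) else 0)"
    by blast
  have 1: "hadamard (\<lambda>x :: 'a ^ 'n. x $ j) (\<lambda>l x y. if l = j then 1 else 0) (\<lambda>l x. if l = j then 1 else 0)"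
    unfolding hadamard_def
  proof (intro conjI allI)
    show "x $ j - y $ j = (\<Sum>l\<in>UNIV. (if l = j then 1 else 0) * (x $ l - y $ l))" for x y :: "'a ^ 'n"
      by (simp add: if_distrib[of "\<lambda>c. c * _"] cong: if_cong)
    show "finite_rank (\<lambda>x y :: 'a ^ 'n. if l = j then 1 else 0 :: 'a)" for l
      by (rule finite_rank_left)
  qed simp
  have eq: "x $ j * (if l = j then of_nat k * (x $ j) ^ (k - 1) else 0) + (if l = j then 1 else 0) * (x $ j) ^ k
      = (if l = j then of_nat (Suc k) * (x $ j) ^ (Suc k - 1) else 0)" for l and x :: "'a ^ 'n"
    by (cases k) (auto simp: algebra_simps)
  show ?case
    using hadamard_mult[OF 1 B] unfolding eq power_Suc[symmetric] by blast
qed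

lemma hadamard_mono_fun:
  fixes e :: "'n::finite \<Rightarrow> nat"
  shows "\<exists>B. hadamard (mono_fun e :: 'a::field ^ 'n \<Rightarrow> 'a) B (\<lambda>l x. of_nat (e l) * mono_fun (e(l := e l - 1)) x)"
proof -
  have "\<exists>B. hadamard (\<lambda>x :: 'a ^ 'n. \<Prod>j\<in>T. (x $ j) ^ e j) B
      (\<lambda>l x. if l \<in> T then of_nat (e l) * (x $ l) ^ (e l - 1) * (\<Prod>j\<in>T - {l}. (x $ j) ^ e j) else 0)"
    if "finite T" for T
    using that
  proof (induction T rule: finite_induct)
    case empty
    show ?case
      using hadamard_const[of 1] by auto
  next
    case (insert k T)
    then obtain B where B: "hadamard (\<lambda>x :: 'a ^ 'n. \<Prod>j\<in>T. (x $ j) ^ e j) B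
      (\<lambda>l x. if l \<in> T then of_nat (e l) * (x $ l) ^ (e l - 1) * (\<Prod>j\<in>T - {l}. (x $ j) ^ e j) else 0)"
      by blast
    obtain B' where B': "hadamard (\<lambda>x :: 'a ^ 'n. (x $ k) ^ e k) B' (\<lambda>l x. if l = k then of_nat (e k) * (x $ k) ^ (e k - 1) else 0)"
      using hadamard_coord_power by blast
    have eq: "(x $ k) ^ e k * (if l \<in> T then of_nat (e l) * (x $ l) ^ (e l - 1) * (\<Prod>j\<in>T - {l}. (x $ j) ^ e j) else 0)
      + (if l = k then of_nat (e k) * (x $ k) ^ (e k - 1) else 0) * (\<Prod>j\<in>T. (x $ j) ^ e j)
      = (if l \<in> insert k T then of_nat (e l) * (x $ l) ^ (e l - 1) * (\<Prod>j\<in>insert k T - {l}. (x $ j) ^ e j) else 0)"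
      for l and x :: "'a ^ 'n"
    proof (cases "l = k")
      case True
      then show ?thesis
        using insert.hyps by simp
    next
      case False
      then have "insert k T - {l} = insert k (T - {l})"
        by auto
      then show ?thesis
        using insert.hyps False by simp
    qed
    have "(\<Prod>j\<in>insert k T. (x $ j) ^ e j) = (x $ k) ^ e k * (\<Prod>j\<in>T. (x $ j) ^ e j)" for x :: "'a ^ 'n"
      using insert.hyps by simp
    then show ?case
      using hadamard_mult[OF B' B] unfolding eq by auto
  qed
  from this[of UNIV] obtain B where B: "hadamard (\<lambda>x :: 'a ^ 'n. \<Prod>j\<in>UNIV. (x $ j) ^ e j) B
      (\<lambda>l x. if l \<in> UNIV then of_nat (e l) * (x $ l) ^ (e l - 1) * (\<Prod>j\<in>UNIV - {l}. (x $ j) ^ e j) else 0)"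
    by auto
  have eq: "of_nat (e l) * (x $ l) ^ (e l - 1) * (\<Prod>j\<in>UNIV - {l}. (x $ j) ^ e j)
      = of_nat (e l) * mono_fun (e(l := e l - 1)) x" for l and x :: "'a ^ 'n"
    unfolding mono_fun_def by (simp add: prod.remove[of _ l] mult.assoc)
  show ?thesis
    using B unfolding mono_fun_def[of e, abs_def] eq by auto
qed

lemma hadamard_degpoly:
  fixes c :: "('n::finite \<Rightarrow> nat) \<Rightarrow> 'a::field"
  shows "\<exists>B. hadamard (degpoly d c) B (\<lambda>l x. \<Sum>e\<in>degs d. c e * (of_nat (e l) * mono_fun (e(l := e l - 1)) x))"
proof -
  have "\<exists>B. hadamard (\<lambda>x :: 'a ^ 'n. c e * mono_fun e x) B (\<lambda>l x. c e * (of_nat (e l) * mono_fun (e(l := e l - 1)) x))" for e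
  proof -
    obtain B where "hadamard (mono_fun e :: 'a ^ 'n \<Rightarrow> 'a) B (\<lambda>l x. of_nat (e l) * mono_fun (e(l := e l - 1)) x)"
      using hadamard_mono_fun by blast
    from hadamard_mult[OF hadamard_const[of "c e"] this] show ?thesis
      by auto
  qed
  then have "\<exists>B. \<forall>e. hadamard (\<lambda>x :: 'a ^ 'n. c e * mono_fun e x) (B e)
      (\<lambda>l x. c e * (of_nat (e l) * mono_fun (e(l := e l - 1)) x))"
    by (intro choice allI)
  then obtain B where B: "\<And>e. hadamard (\<lambda>x :: 'a ^ 'n. c e * mono_fun e x) (B e)
      (\<lambda>l x. c e * (of_nat (e l) * mono_fun (e(l := e l - 1)) x))"
    by blast
  have "hadamard (\<lambda>x. \<Sum>e\<in>degs d. c e * mono_fun e x) (\<lambda>l x y. \<Sum>e\<in>degs d. B e l x y)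
      (\<lambda>l x. \<Sum>e\<in>degs d. c e * (of_nat (e l) * mono_fun (e(l := e l - 1)) x))"
    by (rule hadamard_sum[OF finite_degs B])
  then show ?thesis
    unfolding degpoly_def[abs_def] by blast
qed

lemma degpoly_derivative:
  assumes "d > 0"
  shows "(\<Sum>e\<in>degs d. c e * (of_nat (e l) * mono_fun (e(l := e l - 1)) x))
    = degpoly (d - 1) (\<lambda>e. c (e(l := e l + 1)) * of_nat (e l + 1)) x"
proof -
  have sum_upd: "sum (e(l := k)) UNIV + e l = sum e UNIV + k" for e :: "'b \<Rightarrow> nat" and k
  proof -
    have "sum (e(l := k)) UNIV = k + sum e (UNIV - {l})"
      by (simp add: sum.remove[of _ l])
    moreover have "sum e UNIV = e l + sum e (UNIV - {l})"
      by (simp add: sum.remove[of _ l])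
    ultimately show ?thesis
      by simp
  qed
  have "(\<Sum>e\<in>degs d. c e * (of_nat (e l) * mono_fun (e(l := e l - 1)) x))
    = (\<Sum>e\<in>{e\<in>degs d. e l > 0}. c e * (of_nat (e l) * mono_fun (e(l := e l - 1)) x))"
    using finite_degs by (intro sum.mono_neutral_right) auto
  also have "\<dots> = degpoly (d - 1) (\<lambda>e. c (e(l := e l + 1)) * of_nat (e l + 1)) x"
    unfolding degpoly_def
  proof (rule sum.reindex_bij_witness[where i = "\<lambda>e. e(l := e l + 1)" and j = "\<lambda>e. e(l := e l - 1)"])
    fix e assume e: "e \<in> {e\<in>degs d. e l > 0}"
    then show "e(l := e l - 1) \<in> degs (d - 1)"
      using sum_upd[of e "e l - 1"] by (auto simp: degs_def)
    show "(e(l := e l - 1))(l := (e(l := e l - 1)) l + 1) = e"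
      using e by auto
    show "c ((e(l := e l - 1))(l := (e(l := e l - 1)) l + 1)) * of_nat ((e(l := e l - 1)) l + 1) *
        mono_fun (e(l := e l - 1)) x = c e * (of_nat (e l) * mono_fun (e(l := e l - 1)) x)"
      using e by (auto simp: mult.assoc)
  next
    fix e :: "'b \<Rightarrow> nat" assume e: "e \<in> degs (d - 1)"
    then show "e(l := e l + 1) \<in> {e\<in>degs d. e l > 0}"
      using sum_upd[of e "e l + 1"] assms by (auto simp: degs_def)
    show "(e(l := e l + 1))(l := (e(l := e l + 1)) l - 1) = e"
      by auto
  qed
  finally show ?thesis .
qed

lemma degpoly_polyfun: "degpoly d c \<in> polyfun UNIV"
  unfolding degpoly_def[abs_def] by (intro subalg_sum subalg.mult subalg.const mono_fun_polyfun) auto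

text \<open>All exponents that occur are multiples of \<open>p\<close>, the coefficients have
  \<open>p\<close>-th roots in the algebraically closed field, and taking \<open>p\<close>-th powers
  is additive.\<close>

lemma degpoly_root_CHAR:
  fixes c :: "('n::finite \<Rightarrow> nat) \<Rightarrow> 'a::alg_closed_field"
  assumes p: "p = CHAR('a)" "p > 0" and dvd: "\<And>e l. e \<in> degs d \<Longrightarrow> c e \<noteq> 0 \<Longrightarrow> p dvd e l"
  shows "\<exists>r. \<forall>y. degpoly d c y = degpoly (d div p) r y ^ p"
proof -
  have prime: "prime CHAR('a)"
    using p by (intro prime_CHAR_semidom) simp
  have "\<exists>r. \<forall>e. r e ^ p = c (\<lambda>l. p * e l)"
    by (intro choice allI nth_root_exists p(2))
  then obtain r where r: "\<And>e. r e ^ p = c (\<lambda>l. p * e l)"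
    by blast
  have "degpoly d c y = degpoly (d div p) r y ^ p" for y
  proof -
    have inj: "inj_on (\<lambda>e l. p * e l) (degs (d div p) :: ('n \<Rightarrow> nat) set)"
      using p(2) by (auto simp: inj_on_def fun_eq_iff)
    have sub: "(\<lambda>e l. p * e l) ` degs (d div p) \<subseteq> (degs d :: ('n \<Rightarrow> nat) set)"
      using p(2) by (auto simp: degs_def sum_distrib_left[symmetric] less_eq_div_iff_mult_less_eq mult.commute)
    have "e \<in> (\<lambda>e l. p * e l) ` degs (d div p)" if e: "e \<in> degs d" "c e \<noteq> 0" for e
    proof (rule image_eqI)
      show eq: "e = (\<lambda>l. p * (e l div p))"
        using dvd[OF e] by (auto simp: fun_eq_iff)
      have "sum e UNIV = p * (\<Sum>l\<in>UNIV. e l div p)"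
        by (subst eq) (simp add: sum_distrib_left)
      then show "(\<lambda>l. e l div p) \<in> degs (d div p)"
        using e(1) p(2) by (simp add: degs_def less_eq_div_iff_mult_less_eq mult.commute)
    qed
    then have "degpoly d c y = (\<Sum>e\<in>(\<lambda>e l. p * e l) ` degs (d div p). c e * mono_fun e y)"
      unfolding degpoly_def using sub finite_degs by (intro sum.mono_neutral_right) auto
    also have "\<dots> = (\<Sum>e\<in>degs (d div p). (r e * mono_fun e y) ^ p)"
      unfolding sum.reindex[OF inj]
      by (intro sum.cong refl)
        (simp add: r power_mult_distrib mono_fun_def prod_power_distrib power_mult mult.commute flip: power_mult)
    also have "\<dots> = degpoly (d div p) r y ^ p"
      unfolding degpoly_def by (rule freshmans_dream_sum[OF prime p(1), symmetric])
    finally show ?thesis .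
  qed
  then show ?thesis
    by blast
qed

text \<open>A relation of minimal degree has a non-vanishing partial derivative: otherwise it would be
  constant or, in positive characteristic, a \<open>p\<close>-th power.\<close>

lemma separable_relation:
  fixes Y :: "('a::alg_closed_field ^ 'm) set"
  assumes "Y \<noteq> {}" "f \<in> polyfun UNIV" "\<exists>y. f y \<noteq> 0" "\<And>y. y \<in> Y \<Longrightarrow> f y = 0"
  shows "\<exists>G B \<delta>. hadamard G B \<delta> \<and> (\<forall>l. \<delta> l \<in> polyfun UNIV) \<and> (\<forall>y\<in>Y. G y = 0) \<and> (\<exists>l. \<exists>y\<in>Y. \<delta> l y \<noteq> 0)"
proof -
  define Rel where "Rel d \<longleftrightarrow> (\<exists>c :: ('m \<Rightarrow> nat) \<Rightarrow> 'a. (\<exists>y. degpoly d c y \<noteq> 0) \<and> (\<forall>y\<in>Y. degpoly d c y = 0))" for d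
  obtain d0 c0 where "f = degpoly d0 c0"
    using polyfun_imp_degpoly[OF assms(2)] by blast
  then have "\<exists>d. Rel d"
    using assms(3,4) unfolding Rel_def by blast
  define d where "d = (LEAST d. Rel d)"
  have d_min: "\<not> Rel d'" if "d' < d" for d'
    using that unfolding d_def by (rule not_less_Least)
  have "Rel d"
    unfolding d_def by (rule LeastI_ex) fact
  then obtain c where c: "\<exists>y. degpoly d c y \<noteq> 0" "\<And>y. y \<in> Y \<Longrightarrow> degpoly d c y = 0"
    unfolding Rel_def by blast
  \<comment> \<open>A nonzero constant cannot vanish on the nonempty set \<open>Y\<close>.\<close>
  have nonconst: "\<exists>e\<in>degs d. c e \<noteq> 0 \<and> (\<exists>l. e l \<noteq> 0)"
  proof (rule ccontr)
    assume "\<not> ?thesis"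
    then have *: "e = (\<lambda>_. 0)" if "e \<in> degs d" "c e \<noteq> 0" for e
      using that by (auto simp: fun_eq_iff)
    have "degpoly d c y = (\<Sum>e\<in>{\<lambda>_. 0}. c e * mono_fun e y)" for y
      unfolding degpoly_def using finite_degs *
      by (intro sum.mono_neutral_right) (auto simp: degs_def)
    then show False
      using c assms(1) by auto
  qed
  then have "d > 0"
    by (auto simp: degs_def intro: Nat.gr0I)
  define \<delta> where "\<delta> l y = (\<Sum>e\<in>degs d. c e * (of_nat (e l) * mono_fun (e(l := e l - 1)) y))" for l y
  define c' where "c' l e = c (e(l := e l + 1)) * of_nat (e l + 1)" for l e
  have \<delta>: "\<delta> l = degpoly (d - 1) (c' l)" for l
    unfolding \<delta>_def c'_def degpoly_derivative[OF \<open>d > 0\<close>] by (simp add: fun_eq_iff)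
  have "\<exists>l. \<exists>y\<in>Y. \<delta> l y \<noteq> 0"
  proof (rule ccontr)
    assume "\<not> ?thesis"
    \<comment> \<open>Derivatives vanishing on \<open>Y\<close> have smaller degree, so minimality
      makes them vanish identically. Comparing coefficients then shows that the characteristic
      divides every exponent that occurs.\<close>
    then have "degpoly (d - 1) (c' l) y = 0" for l y
      using d_min[of "d - 1"] \<open>d > 0\<close> unfolding Rel_def \<delta> by auto
    then have c'0: "c' l e = 0" if "e \<in> degs (d - 1)" for l e
      using mono_fun_linear_independent[OF finite_degs _ that] unfolding degpoly_def by blast
    have char: "CHAR('a) dvd e l" if e: "e \<in> degs d" "c e \<noteq> 0" for e l
    proof (cases "e l = 0")
      case False
      have "sum (e(l := e l - 1)) UNIV + 1 = sum e UNIV"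
        using False by (simp add: sum.remove[of _ l])
      then have "e(l := e l - 1) \<in> degs (d - 1)"
        using e(1) by (simp add: degs_def)
      from c'0[OF this, of l] have "c e * of_nat (e l) = 0"
        using False by (simp add: c'_def fun_upd_idem)
      then show ?thesis
        using e(2) by (simp add: of_nat_eq_0_iff_char_dvd)
    qed simp
    have pos: "CHAR('a) > 0"
      using nonconst char by (metis dvd_0_left_iff gr0I)
    then obtain r where r: "\<And>y. degpoly d c y = degpoly (d div CHAR('a)) r y ^ CHAR('a)"
      using degpoly_root_CHAR[of "CHAR('a)" d c] pos char by blast
    have "prime CHAR('a)"
      using pos by (rule prime_CHAR_semidom)
    then have "d div CHAR('a) < d"
      using \<open>d > 0\<close> prime_gt_1_nat[of "CHAR('a)"] by simp
    moreover have "Rel (d div CHAR('a))"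
      unfolding Rel_def using c pos unfolding r by (intro exI[of _ r]) auto
    ultimately show False
      using d_min by blast
  qed
  moreover have "\<delta> l \<in> polyfun UNIV" for l
    unfolding \<delta> by (rule degpoly_polyfun)
  moreover obtain B where "hadamard (degpoly d c) B \<delta>"
    using hadamard_degpoly[of d c] unfolding \<delta>_def by blast
  ultimately show ?thesis
    using c(2) by blast
qed

section \<open>Tangent spaces and linear maps\<close>

lemma linear_polynomial_map_affine:
  assumes "linear_polynomial_map f"
  shows "\<exists>A. \<forall>x y l. f x $ l - f y $ l = (\<Sum>t\<in>UNIV. A l t * (x $ t - y $ t))"
proof -
  obtain P where P: "\<And>l. linear_mvpoly (P l)" "\<And>x l. f x $ l = mvpoly_eval (P l) x"
    using assms unfolding linear_polynomial_map_def by blast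
  \<comment> \<open>In degree at most one, weighting each coefficient by the exponent of
    \<open>t\<close> selects the coefficient of that variable and drops the constant term.\<close>
  define A where "A l t = (\<Sum>e\<in>Poly_Mapping.keys (P l).
    Poly_Mapping.lookup (P l) e * of_nat (Poly_Mapping.lookup e t))" for l t
  have mono: "mono_fun e x - mono_fun e y = (\<Sum>t\<in>UNIV. of_nat (e t) * (x $ t - y $ t))"
    if "sum e UNIV \<le> 1" for e and x y :: "'a ^ 'b"
  proof (cases "sum e UNIV = 0")
    case True
    then have "e t = 0" for t
      by simp
    then have "e = (\<lambda>_. 0)"
      by blast
    then show ?thesis
      by simp
  next
    case False
    then have "sum e UNIV = 1"
      using that by linarith
    then obtain t where t: "e t = 1" "\<And>s. s \<noteq> t \<Longrightarrow> e s = 0"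
      using sum_eq_1_iff[of UNIV e] by auto
    have "mono_fun e z = z $ t" for z :: "'a ^ 'b"
      unfolding mono_fun_def using t by (subst prod.remove[of _ t]) auto
    moreover have "(\<Sum>s\<in>UNIV. of_nat (e s) * (x $ s - y $ s)) = x $ t - y $ t"
      using t by (subst sum.remove[of _ t]) auto
    ultimately show ?thesis
      by simp
  qed
  have "f x $ l - f y $ l = (\<Sum>t\<in>UNIV. A l t * (x $ t - y $ t))" for x y l
  proof -
    have "f x $ l - f y $ l = (\<Sum>e\<in>Poly_Mapping.keys (P l). Poly_Mapping.lookup (P l) e *
        (mono_fun (Poly_Mapping.lookup e) x - mono_fun (Poly_Mapping.lookup e) y))"
      unfolding P(2) mvpoly_eval_superset[OF finite_keys order_refl] right_diff_distrib sum_subtractf ..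
    also have "\<dots> = (\<Sum>e\<in>Poly_Mapping.keys (P l). \<Sum>t\<in>UNIV.
        Poly_Mapping.lookup (P l) e * (of_nat (Poly_Mapping.lookup e t) * (x $ t - y $ t)))"
      using P(1)[of l] by (intro sum.cong refl) (simp add: linear_mvpoly_def mono sum_distrib_left)
    also have "\<dots> = (\<Sum>t\<in>UNIV. A l t * (x $ t - y $ t))"
      unfolding A_def sum_distrib_right by (subst sum.swap) (simp add: mult.assoc)
    finally show ?thesis .
  qed
  then show ?thesis
    by blast
qed

lemma det_eq_0_if_kernel:
  fixes M :: "'a::field ^ 'n ^ 'n"
  assumes "M *v w = 0" "w \<noteq> 0"
  shows "det M = 0"
proof (rule ccontr)
  assume "det M \<noteq> 0"
  then obtain N where "N ** M = mat 1"
    using invertible_det_nz[of M] by (auto simp: invertible_def)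
  then have "w = N *v (M *v w)"
    by (simp add: matrix_vector_mul_assoc)
  then show False
    using assms by simp
qed

text \<open>Besides the dimension bound, the lemma supplies an invertible matrix whose rows are a
  maximal independent subset \<open>S0\<close> of \<open>R\<close> completed by coordinate vectors.
  It becomes the Jacobian matrix in \<open>tangent_subspace\<close>.\<close>

lemma annihilator_dim:
  fixes R :: "('a::field ^ 'n) set"
  assumes "finite R"
  obtains S0 Q where "S0 \<subseteq> R" and "Q = {w. \<forall>r\<in>R. (\<Sum>t\<in>UNIV. r $ t * w $ t) = 0}"
    and "vec.subspace Q" and "CARD('n) \<le> vec.dim Q + card S0"
    and "\<exists>\<sigma>. det (\<chi> j. \<sigma> j) \<noteq> 0 \<and> S0 \<subseteq> range \<sigma> \<and> inj \<sigma> \<and> range \<sigma> \<subseteq> S0 \<union> cart_basis"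
proof -
  define Q where "Q = {w. \<forall>r\<in>R. (\<Sum>t\<in>UNIV. r $ t * w $ t) = 0}"
  obtain S0 where S0: "S0 \<subseteq> R" "vec.independent S0" "R \<subseteq> vec.span S0"
    using vec.maximal_independent_subset by blast
  obtain B where B: "S0 \<subseteq> B" "B \<subseteq> S0 \<union> cart_basis" "vec.independent B" "S0 \<union> cart_basis \<subseteq> vec.span B"
    using vec.maximal_independent_subset_extend[of S0 "S0 \<union> cart_basis"] S0(2) by blast
  have span: "vec.span B = UNIV"
    using B(4) vec.span_minimal[OF _ vec.subspace_span, of cart_basis B] by auto
  have "finite B"
    using B(3) by (rule vec.finiteI_independent)
  have "card B = card (cart_basis :: ('a ^ 'n) set)"
    using vec.dim_eq_card[of B UNIV] vec.dim_eq_card[of cart_basis UNIV] B(3) span independent_cart_basis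
    by (simp add: vec.span_UNIV)
  then have "card (UNIV :: 'n set) = card B"
    by (simp add: card_cart_basis)
  then obtain \<sigma> where \<sigma>: "bij_betw \<sigma> (UNIV :: 'n set) B"
    using finite_same_card_bij[of "UNIV :: 'n set" B] \<open>finite B\<close> by auto
  define N where "N = (\<chi> j. \<sigma> j)"
  have "rows N = B"
    using \<sigma> by (auto simp: rows_def row_def N_def bij_betw_def)
  then obtain N' where "N' ** N = mat 1"
    using matrix_left_invertible_span_rows_gen[of N] span by auto
  then have N': "N ** N' = mat 1"
    by (simp add: matrix_left_right_inverse)
  have det: "det N \<noteq> 0"
    using invertible_det_nz[of N] N' \<open>N' ** N = mat 1\<close> by (auto simp: invertible_def)
  define J where "J = {j. \<sigma> j \<in> S0}"
  have "card J = card S0"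
  proof -
    have "\<sigma> ` J = S0"
      using \<sigma> B(1) by (auto simp: J_def bij_betw_def)
    then show ?thesis
      using card_image[of \<sigma> J] \<sigma> by (metis bij_betw_def inj_on_subset subset_UNIV)
  qed
  \<comment> \<open>The inverse matrix sends the unit vectors for rows outside \<open>S0\<close> to
    dual basis vectors; these are annihilated by \<open>S0\<close>, hence by all of
    \<open>R\<close>.\<close>
  define D where "D = (\<lambda>j. axis j 1 :: 'a ^ 'n) ` (- J)"
  have inj_axis: "inj (\<lambda>j. axis j 1 :: 'a ^ 'n)"
    by (auto simp: inj_def axis_eq_axis)
  have "vec.independent D"
    by (rule vec.independent_mono[OF independent_cart_basis]) (auto simp: D_def cart_basis_def)
  have inj: "inj ((*v) N')"
  proof (rule injI)
    fix x y assume "N' *v x = N' *v y"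
    then have "N *v (N' *v x) = N *v (N' *v y)"
      by simp
    then show "x = y"
      by (simp add: matrix_vector_mul_assoc N')
  qed
  have "vec.independent ((*v) N' ` D)"
    by (rule vec.linear_independent_injective_image)
      (use \<open>vec.independent D\<close> inj in \<open>auto intro: matrix_vector_mul_linear_gen inj_on_subset\<close>)
  moreover have "(*v) N' ` D \<subseteq> Q"
  proof
    fix w assume "w \<in> (*v) N' ` D"
    then obtain j where j: "j \<notin> J" "w = N' *v axis j 1"
      by (auto simp: D_def)
    have "N *v w = axis j 1"
      by (simp add: j matrix_vector_mul_assoc N')
    then have \<sigma>w: "(\<Sum>t\<in>UNIV. \<sigma> i $ t * w $ t) = axis j 1 $ i" for i
      by (auto simp: vec_eq_iff matrix_vector_mult_def N_def)
    have "(\<Sum>t\<in>UNIV. r $ t * w $ t) = 0" if r: "r \<in> S0" for r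
    proof -
      obtain i where "r = \<sigma> i" "i \<in> J"
        using \<sigma> B(1) r unfolding J_def bij_betw_def by blast
      then show ?thesis
        using \<sigma>w[of i] j(1) by (auto simp: axis_def)
    qed
    moreover have "vec.subspace {r. (\<Sum>t\<in>UNIV. r $ t * w $ t) = 0}"
      by (auto simp: vec.subspace_def distrib_right sum.distrib mult.assoc sum_distrib_left[symmetric])
    ultimately have "vec.span S0 \<subseteq> {r. (\<Sum>t\<in>UNIV. r $ t * w $ t) = 0}"
      by (intro vec.span_minimal) auto
    then show "w \<in> Q"
      using S0(3) by (auto simp: Q_def)
  qed
  ultimately have "card ((*v) N' ` D) \<le> vec.dim Q"
    by (intro vec.independent_card_le_dim)
  moreover have "card ((*v) N' ` D) = card (- J)"
    using inj inj_axis unfolding D_def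
    by (simp add: card_image inj_on_subset)
  moreover have "card (- J) + card S0 = CARD('n)"
    using card_Un_disjoint[of J "- J"] \<open>card J = card S0\<close> by (simp add: Compl_partition)
  ultimately have dim: "CARD('n) \<le> vec.dim Q + card S0"
    by simp
  have sub: "vec.subspace Q"
    unfolding vec.subspace_def Q_def
    by (auto simp: distrib_left sum.distrib mult.left_commute sum_distrib_left[symmetric])
  have "\<exists>\<sigma>. det (\<chi> j. \<sigma> j) \<noteq> 0 \<and> S0 \<subseteq> range \<sigma> \<and> inj \<sigma> \<and> range \<sigma> \<subseteq> S0 \<union> cart_basis"
    using \<sigma> B(1,2) det unfolding N_def bij_betw_def by (intro exI[of _ \<sigma>]) auto
  then show ?thesis
    using that[OF S0(1) Q_def sub dim] by blast
qed

lemma tangent_subspace: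
  fixes C :: "nat \<Rightarrow> ('a::alg_closed_field ^ 'n) set" and \<phi> :: "'i \<Rightarrow> 'a ^ 'n \<Rightarrow> 'a ^ 'm"
  assumes chain: "irreducible_chain k C" and I: "finite I"
    and \<phi>: "\<And>i l. i \<in> I \<Longrightarrow> (\<lambda>x. \<phi> i x $ l) \<in> polyfun UNIV"
    and A: "\<And>i x y l. i \<in> I \<Longrightarrow> \<phi> i x $ l - \<phi> i y $ l = (\<Sum>t\<in>UNIV. A i l t * (x $ t - y $ t))"
    and dep: "\<And>i. i \<in> I \<Longrightarrow> \<exists>f\<in>polyfun UNIV. (\<exists>y. f y \<noteq> 0) \<and> (\<forall>x\<in>C k. f (\<phi> i x) = 0)"
  shows "\<exists>W. vec.subspace W \<and> k \<le> vec.dim W \<and>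
    (\<forall>i\<in>I. \<exists>\<nu>. (\<exists>l. \<nu> l \<noteq> 0) \<and> (\<forall>w\<in>W. (\<Sum>l\<in>UNIV. \<nu> l * (\<Sum>t\<in>UNIV. A i l t * w $ t)) = 0))"
proof -
  define V where "V = C k"
  have prime: "prime_set V" and "V \<noteq> {}"
    using chain by (auto simp: irreducible_chain_def zariski_irreducible_iff V_def prime_set_def)
  have "\<exists>p. hadamard (fst p) (fst (snd p)) (snd (snd p)) \<and> (\<forall>l. snd (snd p) l \<in> polyfun UNIV) \<and>
      (\<forall>x\<in>V. fst p (\<phi> i x) = 0) \<and> (\<exists>l. \<exists>x\<in>V. snd (snd p) l (\<phi> i x) \<noteq> 0)" if i: "i \<in> I" for i
  proof -
    obtain f where f: "f \<in> polyfun UNIV" "\<exists>y. f y \<noteq> 0" "\<And>y. y \<in> \<phi> i ` V \<Longrightarrow> f y = 0"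
      using dep[OF i] unfolding V_def by blast
    have "\<exists>G B \<delta>. hadamard G B \<delta> \<and> (\<forall>l. \<delta> l \<in> polyfun UNIV) \<and>
        (\<forall>y\<in>\<phi> i ` V. G y = 0) \<and> (\<exists>l. \<exists>y\<in>\<phi> i ` V. \<delta> l y \<noteq> 0)"
      by (rule separable_relation[of _ f]) (use f \<open>V \<noteq> {}\<close> in auto)
    then obtain G B \<delta> where "hadamard G B \<delta> \<and> (\<forall>l. \<delta> l \<in> polyfun UNIV) \<and>
        (\<forall>y\<in>\<phi> i ` V. G y = 0) \<and> (\<exists>l. \<exists>y\<in>\<phi> i ` V. \<delta> l y \<noteq> 0)"
      by (elim exE)
    then show ?thesis
      by (intro exI[of _ "(G, B, \<delta>)"]) auto
  qed
  then have "\<exists>p. \<forall>i\<in>I. hadamard (fst (p i)) (fst (snd (p i))) (snd (snd (p i))) \<and>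
      (\<forall>l. snd (snd (p i)) l \<in> polyfun UNIV) \<and>
      (\<forall>x\<in>V. fst (p i) (\<phi> i x) = 0) \<and> (\<exists>l. \<exists>x\<in>V. snd (snd (p i)) l (\<phi> i x) \<noteq> 0)"
    by (intro bchoice ballI)
  then obtain p where p: "\<forall>i\<in>I. hadamard (fst (p i)) (fst (snd (p i))) (snd (snd (p i))) \<and>
      (\<forall>l. snd (snd (p i)) l \<in> polyfun UNIV) \<and>
      (\<forall>x\<in>V. fst (p i) (\<phi> i x) = 0) \<and> (\<exists>l. \<exists>x\<in>V. snd (snd (p i)) l (\<phi> i x) \<noteq> 0)" ..
  define G where "G i = fst (p i)" for i
  define B where "B i = fst (snd (p i))" for i
  define \<delta> where "\<delta> i = snd (snd (p i))" for i
  have had: "hadamard (G i) (B i) (\<delta> i)" and \<delta>: "\<delta> i l \<in> polyfun UNIV"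
    and G0: "\<And>x. x \<in> V \<Longrightarrow> G i (\<phi> i x) = 0" and "\<exists>l. \<exists>x\<in>V. \<delta> i l (\<phi> i x) \<noteq> 0" if "i \<in> I" for i l
    using bspec[OF p that] by (simp_all add: G_def B_def \<delta>_def)
  then have "\<exists>L. \<forall>i\<in>I. \<exists>x\<in>V. \<delta> i (L i) (\<phi> i x) \<noteq> 0"
    by (intro bchoice ballI)
  then obtain L where L: "\<And>i. i \<in> I \<Longrightarrow> \<exists>x\<in>V. \<delta> i (L i) (\<phi> i x) \<noteq> 0"
    by blast
  have \<delta>\<phi>: "(\<lambda>x. \<delta> i l (\<phi> i x)) \<in> polyfun UNIV" if "i \<in> I" for i l
    by (rule subalg_comp[OF \<delta>[OF that]]) (use \<phi>[OF that] in \<open>auto simp: coord_def\<close>)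
  obtain a where a: "a \<in> V" "(\<Prod>i\<in>I. \<delta> i (L i) (\<phi> i a)) \<noteq> 0"
    using prime_set_prod[OF prime I, of "\<lambda>i x. \<delta> i (L i) (\<phi> i x)"] \<delta>\<phi> L by blast
  then have a_nz: "\<delta> i (L i) (\<phi> i a) \<noteq> 0" if "i \<in> I" for i
    using I that by auto
  \<comment> \<open>The chain rule for difference quotients: \<open>K i\<close> belongs to
    \<open>G i\<close> composed with \<open>\<phi> i\<close>, and its diagonal is the gradient. Thus
    \<open>v i\<close> is the gradient at the generic point \<open>a\<close>.\<close>
  define K where "K i x y t = (\<Sum>l\<in>UNIV. B i l (\<phi> i x) (\<phi> i y) * A i l t)" for i x y t
  define v where "v i = (\<chi> t. K i a a t)" for i
  have K_diag: "K i x x t = (\<Sum>l\<in>UNIV. \<delta> i l (\<phi> i x) * A i l t)" if "i \<in> I" for i x t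
    using had[OF that] by (simp add: K_def hadamard_def)
  obtain S0 Q where S0: "S0 \<subseteq> v ` I" and Q: "Q = {w. \<forall>r\<in>v ` I. (\<Sum>t\<in>UNIV. r $ t * w $ t) = 0}"
    and sub: "vec.subspace Q" and dim: "CARD('n) \<le> vec.dim Q + card S0"
    and "\<exists>\<sigma>. det (\<chi> j. \<sigma> j) \<noteq> 0 \<and> S0 \<subseteq> range \<sigma> \<and> inj \<sigma> \<and> range \<sigma> \<subseteq> S0 \<union> cart_basis"
    by (rule annihilator_dim[of "v ` I"]) (use I in blast)+
  then obtain \<sigma> where \<sigma>: "det (\<chi> j. \<sigma> j) \<noteq> 0" "S0 \<subseteq> range \<sigma>" "inj \<sigma>" "range \<sigma> \<subseteq> S0 \<union> cart_basis"
    by blast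
  have "k \<le> vec.dim Q"
  proof (rule ccontr)
    assume "\<not> k \<le> vec.dim Q"
    define J where "J = {j. \<sigma> j \<in> S0}"
    have "\<forall>j\<in>J. \<exists>i. i \<in> I \<and> \<sigma> j = v i"
      using S0 by (auto simp: J_def)
    then obtain \<iota> where \<iota>: "\<And>j. j \<in> J \<Longrightarrow> \<iota> j \<in> I" "\<And>j. j \<in> J \<Longrightarrow> \<sigma> j = v (\<iota> j)"
      using bchoice[of J "\<lambda>j i. i \<in> I \<and> \<sigma> j = v i"] by blast
    have "\<forall>j\<in>-J. \<exists>t. \<sigma> j = axis t 1"
      using \<sigma>(4) by (auto simp: J_def cart_basis_def)
    then obtain \<beta> where \<beta>: "\<And>j. j \<notin> J \<Longrightarrow> \<sigma> j = axis (\<beta> j) 1"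
      using bchoice[of "-J" "\<lambda>j t. \<sigma> j = axis t 1"] by blast
    \<comment> \<open>These coordinates complete \<open>S0\<close> to a basis. Their number is at
      most \<open>CARD('n) - card S0\<close>, hence below \<open>k\<close> if
      \<open>vec.dim Q\<close> is.\<close>
    define Z where "Z = \<beta> ` (- J)"
    have "card S0 \<le> card J"
    proof -
      have "S0 \<subseteq> \<sigma> ` J"
        using \<sigma>(2) by (auto simp: J_def)
      then show ?thesis
        by (metis card_image_le card_mono finite finite_imageI le_trans)
    qed
    then have "card Z + card S0 \<le> CARD('n)"
      using card_image_le[of "- J" \<beta>] card_Un_disjoint[of J "- J"] by (simp add: Compl_partition Z_def)
    then have Z: "card Z < k"
      using dim \<open>\<not> k \<le> vec.dim Q\<close> by simp
    \<comment> \<open>Rows in \<open>J\<close> are difference quotients, the others fix the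
      coordinates in \<open>Z\<close>. At \<open>(a, a)\<close> this is the invertible matrix with
      rows \<open>\<sigma>\<close>.\<close>
    define M :: "'a ^ 'n \<Rightarrow> 'a ^ 'n \<Rightarrow> 'a ^ 'n ^ 'n" where
      "M x y = (\<chi> j t. if j \<in> J then K (\<iota> j) x y t else if t = \<beta> j then 1 else 0)" for x y
    have rank: "finite_rank (\<lambda>x y. det (M x y))"
    proof (rule finite_rank_det)
      fix j t
      show "finite_rank (\<lambda>x y. M x y $ j $ t)"
      proof (cases "j \<in> J")
        case True
        have "finite_rank (\<lambda>x y. B (\<iota> j) l (\<phi> (\<iota> j) x) (\<phi> (\<iota> j) y))" for l
          by (rule finite_rank_comp) (use had[OF \<iota>(1)[OF True]] in \<open>simp add: hadamard_def\<close>)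
        then have "finite_rank (\<lambda>x y. K (\<iota> j) x y t)"
          unfolding K_def by (intro finite_rank_sum finite_rank_mult finite_rank_left)
        then show ?thesis
          using True by (simp add: M_def)
      next
        case False
        then show ?thesis
          by (simp add: M_def finite_rank_left[of "\<lambda>_. 1"] finite_rank_left[of "\<lambda>_. 0"])
      qed
    qed
    \<comment> \<open>Polynomiality is needed on the diagonal only, where \<open>K_diag\<close>
      replaces difference quotients by derivatives.\<close>
    have h: "(\<lambda>x. det (M x x)) \<in> polyfun UNIV"
      unfolding det_def
    proof (intro subalg_sum subalg.mult subalg.const subalg_prod)
      fix j and \<pi> :: "'n \<Rightarrow> 'n"
      show "(\<lambda>x. M x x $ j $ \<pi> j) \<in> polyfun UNIV"
      proof (cases "j \<in> J")
        case True
        have "(\<lambda>x. K (\<iota> j) x x (\<pi> j)) \<in> polyfun UNIV"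
          unfolding K_diag[OF \<iota>(1)[OF True]]
          by (intro subalg_sum subalg.mult subalg.const \<delta>\<phi>[OF \<iota>(1)[OF True]])
        then show ?thesis
          using True by (simp add: M_def)
      next
        case False
        then show ?thesis
          by (simp add: M_def subalg.const)
      qed
    qed
    have Maa: "M a a = (\<chi> j. \<sigma> j)"
      using \<iota>(2) \<beta> by (auto simp: M_def vec_eq_iff v_def axis_def)
    have "\<exists>x\<in>C k. det (M x x) \<noteq> 0"
      using \<sigma>(1) a(1) Maa unfolding V_def by (intro bexI[of _ a]) simp_all
    then obtain P where P: "P \<subseteq> C k" "infinite P" "\<And>x. x \<in> P \<Longrightarrow> det (M x x) \<noteq> 0"
        "\<And>x y z. x \<in> P \<Longrightarrow> y \<in> P \<Longrightarrow> z \<in> Z \<Longrightarrow> x $ z = y $ z"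
      by (rule infinite_fiber[OF chain Z h]) (rule that)
    \<comment> \<open>The difference \<open>x - y\<close> lies in the kernel: rows in
      \<open>J\<close> give differences of values of \<open>G\<close>, which vanish on the images of
      \<open>V\<close>, and the other rows compare coordinates in \<open>Z\<close>.\<close>
    have "det (M x y) = 0" if xy: "x \<in> P" "y \<in> P" "x \<noteq> y" for x y
    proof (rule det_eq_0_if_kernel)
      show "M x y *v (x - y) = 0"
      proof (subst vec_eq_iff, intro allI)
        fix j
        show "(M x y *v (x - y)) $ j = 0 $ j"
        proof (cases "j \<in> J")
          case True
          define i where "i = \<iota> j"
          have i: "i \<in> I"
            using \<iota>(1)[OF True] by (simp add: i_def)
          have "(M x y *v (x - y)) $ j = (\<Sum>t\<in>UNIV. K i x y t * (x $ t - y $ t))"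
            using True by (simp add: matrix_vector_mult_def M_def i_def)
          also have "\<dots> = (\<Sum>l\<in>UNIV. B i l (\<phi> i x) (\<phi> i y) * (\<Sum>t\<in>UNIV. A i l t * (x $ t - y $ t)))"
            unfolding K_def sum_distrib_left sum_distrib_right by (subst sum.swap) (simp add: mult.assoc)
          also have "\<dots> = G i (\<phi> i x) - G i (\<phi> i y)"
            using had[OF i] by (simp add: A[OF i, symmetric] hadamard_def)
          also have "\<dots> = 0"
            using G0[OF i, of x] G0[OF i, of y] xy P(1) by (auto simp: V_def subset_iff)
          finally show ?thesis
            by simp
        next
          case False
          have "(M x y *v (x - y)) $ j = x $ \<beta> j - y $ \<beta> j"
            using False
            by (simp add: matrix_vector_mult_def M_def if_distrib[of "\<lambda>c. c * _"] cong: if_cong)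
          then show ?thesis
            using P(4)[OF xy(1,2), of "\<beta> j"] False by (simp add: Z_def)
        qed
      qed
    qed (use xy in simp)
    then have "finite P"
      using P(3) by (intro finite_rank_diagonal[OF rank])
    then show False
      using P(2) by blast
  qed
  moreover have "\<exists>\<nu>. (\<exists>l. \<nu> l \<noteq> 0) \<and> (\<forall>w\<in>Q. (\<Sum>l\<in>UNIV. \<nu> l * (\<Sum>t\<in>UNIV. A i l t * w $ t)) = 0)"
    if i: "i \<in> I" for i
  \<comment> \<open>The functional is the gradient of \<open>G i\<close> at the image of
    \<open>a\<close>; applied after the linear part of \<open>\<phi> i\<close> it becomes pairing
    with \<open>v i\<close>, which vanishes on \<open>Q\<close>.\<close>
  proof (intro exI[of _ "\<lambda>l. \<delta> i l (\<phi> i a)"] conjI ballI)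
    show "\<exists>l. \<delta> i l (\<phi> i a) \<noteq> 0"
      using a_nz[OF i] by blast
    fix w assume "w \<in> Q"
    then have "(\<Sum>t\<in>UNIV. v i $ t * w $ t) = 0"
      using i by (auto simp: Q)
    moreover have "(\<Sum>t\<in>UNIV. v i $ t * w $ t) = (\<Sum>l\<in>UNIV. \<delta> i l (\<phi> i a) * (\<Sum>t\<in>UNIV. A i l t * w $ t))"
      unfolding v_def sum_distrib_left
      by (subst sum.swap) (simp add: K_diag[OF i] sum_distrib_right mult.assoc)
    ultimately show "(\<Sum>l\<in>UNIV. \<delta> i l (\<phi> i a) * (\<Sum>t\<in>UNIV. A i l t * w $ t)) = 0"
      by simp
  qed
  ultimately show ?thesis
    using sub by blast
qed

lemma zariski_closure_subset: "zariski_closed U \<Longrightarrow> X \<subseteq> U \<Longrightarrow> zariski_closure X \<subseteq> U"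
  by (auto simp: zariski_closure_def)

lemma zariski_closure_proper_imp_relation:
  fixes X :: "('a::alg_closed_field ^ 'm) set"
  assumes "zariski_closure X \<noteq> UNIV"
  obtains f where "f \<in> polyfun UNIV" "\<exists>y. f y \<noteq> 0" "\<And>y. y \<in> X \<Longrightarrow> f y = 0"
proof -
  obtain y U where U: "zariski_closed U" "X \<subseteq> U" "y \<notin> U"
    using assms unfolding zariski_closure_def by blast
  obtain f where "f \<in> polyfun UNIV" "\<And>z. z \<in> U \<Longrightarrow> f z = 0" "f y \<noteq> 0"
    using zariski_closed_separation[OF U(1,3)] by blast
  then show ?thesis
    using that[of f] U(2) by blast
qed

section \<open>From varieties to linear subspaces\<close>

theorem theorem5p3:
  fixes \<phi> :: "nat \<Rightarrow> 'a::alg_closed_field ^ 'n \<Rightarrow> 'a ^ 'm"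
    and k l :: nat and \<epsilon> :: real
  assumes "linear_seeded_rank_extractor_subspaces k \<epsilon> l \<phi>"
  shows "linear_seeded_rank_extractor_varieties k \<epsilon> l \<phi>"
proof -
  have card: "CARD('m) \<le> CARD('n)" and poly: "\<And>i. i \<in> {1..l} \<Longrightarrow> polynomial_map (\<phi> i)"
    and ext: "\<And>V. vec.subspace V \<Longrightarrow> k \<le> vec.dim V \<Longrightarrow> real (card (rank_failures l \<phi> V)) \<le> \<epsilon> * real l"
    and lin: "\<And>i. i \<in> {1..l} \<Longrightarrow> linear_polynomial_map (\<phi> i)"
    using assms
    by (auto simp: linear_seeded_rank_extractor_subspaces_def seeded_rank_extractor_subspaces_def)
  have \<phi>: "(\<lambda>x. \<phi> i x $ j) \<in> polyfun UNIV" if i: "i \<in> {1..l}" for i j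
  proof -
    obtain P where "\<And>x j. \<phi> i x $ j = mvpoly_eval (P j) x"
      using poly[OF i] unfolding polynomial_map_def by blast
    then show ?thesis
      using mvpoly_eval_polyfun[of "P j"] by simp
  qed
  have "\<exists>A. \<forall>i\<in>{1..l}. \<forall>x y j. \<phi> i x $ j - \<phi> i y $ j = (\<Sum>t\<in>UNIV. A i j t * (x $ t - y $ t))"
    by (intro bchoice ballI linear_polynomial_map_affine lin)
  then obtain A where A: "\<And>i x y j. i \<in> {1..l} \<Longrightarrow>
      \<phi> i x $ j - \<phi> i y $ j = (\<Sum>t\<in>UNIV. A i j t * (x $ t - y $ t))"
    by blast
  have "real (card (rank_failures l \<phi> V)) \<le> \<epsilon> * real l"
    if V: "zariski_closed V" "ereal (real k) \<le> zariski_dim V" for V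
  proof -
    obtain C where C: "irreducible_chain k C" "\<And>i. i \<le> k \<Longrightarrow> C i \<subseteq> V"
      using le_zariski_dim_imp_chain[OF V(2)] by blast
    define I where "I = rank_failures l \<phi> V"
    have I: "I \<subseteq> {1..l}"
      by (auto simp: I_def rank_failures_def)
    \<comment> \<open>The function vanishes on the image of all of \<open>V\<close>, hence on the
      image of the irreducible subvariety \<open>C k\<close>.\<close>
    have dep: "\<exists>f\<in>polyfun UNIV. (\<exists>y. f y \<noteq> 0) \<and> (\<forall>x\<in>C k. f (\<phi> i x) = 0)" if i: "i \<in> I" for i
    proof -
      have "zariski_closure (\<phi> i ` V) \<noteq> UNIV"
        using i zariski_dim_UNIV by (auto simp: I_def rank_failures_def)
      then obtain f where "f \<in> polyfun UNIV" "\<exists>y. f y \<noteq> 0" "\<And>y. y \<in> \<phi> i ` V \<Longrightarrow> f y = 0"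
        using zariski_closure_proper_imp_relation by blast
      then show ?thesis
        using C(2)[of k] by blast
    qed
    have "\<exists>W. vec.subspace W \<and> k \<le> vec.dim W \<and> (\<forall>i\<in>I. \<exists>\<nu>. (\<exists>j. \<nu> j \<noteq> 0) \<and>
        (\<forall>w\<in>W. (\<Sum>j\<in>UNIV. \<nu> j * (\<Sum>t\<in>UNIV. A i j t * w $ t)) = 0))"
    proof (rule tangent_subspace[where \<phi> = \<phi>, OF C(1)])
      show "finite I"
        using I finite_subset by blast
    qed (use I \<phi> A dep in blast)+
    then obtain W where W: "vec.subspace W" "k \<le> vec.dim W" and
      \<nu>: "\<forall>i\<in>I. \<exists>\<nu>. (\<exists>j. \<nu> j \<noteq> 0) \<and>
        (\<forall>w\<in>W. (\<Sum>j\<in>UNIV. \<nu> j * (\<Sum>t\<in>UNIV. A i j t * w $ t)) = 0)"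
      by (elim exE conjE) (rule that)
    have "i \<in> rank_failures l \<phi> W" if i: "i \<in> I" for i
    proof -
      obtain \<nu> where \<nu>0: "(\<exists>j. \<nu> j \<noteq> 0) \<and>
          (\<forall>w\<in>W. (\<Sum>j\<in>UNIV. \<nu> j * (\<Sum>t\<in>UNIV. A i j t * w $ t)) = 0)"
        using bspec[OF \<nu> i] by (elim exE)
      then obtain j where j: "\<nu> j \<noteq> 0"
        by blast
      \<comment> \<open>The zero set of \<open>H\<close> is a proper affine hyperplane through the
        image of the origin and contains the image of \<open>W\<close>. Subtracting the value at
        zero takes care of the constant terms of \<open>\<phi> i\<close>.\<close>
      define H where "H y = (\<Sum>j\<in>UNIV. \<nu> j * (y $ j - \<phi> i 0 $ j))" for y
      have "H \<in> polyfun UNIV"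
        unfolding H_def
        by (intro subalg_sum subalg.mult subalg_diff subalg.const nth_polyfun UNIV_I)
      then have "zariski_closed {y. H y = 0}"
        by (rule zariski_closed_zeros)
      moreover have "H (\<phi> i w) = 0" if "w \<in> W" for w
      proof -
        have "\<phi> i w $ j - \<phi> i 0 $ j = (\<Sum>t\<in>UNIV. A i j t * w $ t)" for j
          using A[of i w j 0] i I by auto
        then show ?thesis
          using \<nu>0 that by (simp add: H_def)
      qed
      then have "\<phi> i ` W \<subseteq> {y. H y = 0}"
        by auto
      ultimately have "zariski_closure (\<phi> i ` W) \<subseteq> {y. H y = 0}"
        by (rule zariski_closure_subset)
      moreover have "H (\<phi> i 0 + axis j 1) \<noteq> 0"
        using j by (simp add: H_def axis_def if_distrib[of "\<lambda>c. _ * c"] cong: if_cong)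
      ultimately have "zariski_closure (\<phi> i ` W) \<noteq> UNIV"
        by blast
      then show ?thesis
        using zariski_dim_proper i I by (auto simp: rank_failures_def)
    qed
    then have "I \<subseteq> rank_failures l \<phi> W"
      by blast
    then have "card I \<le> card (rank_failures l \<phi> W)"
      by (intro card_mono) (auto simp: rank_failures_def)
    then show ?thesis
      using ext[OF W] by (simp add: I_def)
  qed
  then show ?thesis
    using card poly lin
    by (simp add: linear_seeded_rank_extractor_varieties_def seeded_rank_extractor_varieties_def)
qed

end
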